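(* Let $k\geq 2$, $m\geq1$, $r\geq1$ be integers and $\varepsilon>0$. Then, up to isomorphism, there are only finitely many finite connected $k$-regular $m$-periodic $r$-normal digraphs $\mathcal{D}$ with $\rho(\mathcal{D})\leq\sqrt{k}-\varepsilon$. Equivalently, there is no infinite almost-normal family of $k$-regular $m$-periodic digraphs $\mathcal{D}$ with $\rho(\mathcal{D})\leq\sqrt{k}-\varepsilon$.
   Context: A digraph $\mathcal{D}$ is $k$-regular if every vertex has exactly $k$ outgoing and $k$ incoming edges; $A_{\mathcal{D}}$ has $(v,w)$ entry the number of edges $v\to w$. It is $m$-periodic if $m$ is its period, i.e. the largest integer such that $V=\coprod_{j=0}^{m-1}V_j$ with every edge from $V_j$ going to $V_{(j+1\bmod m)}$. The eigenvalues of absolute value $k$ are $e^{2\pi it/m}k$ with eigenfunctions $\sum_j e^{2\pi ijt/m}\mathbb{1}_{V_j}$ (trivial ones); $L^2_0$ is the orthogonal complement of these in $L^2(V)$ and $\rho(\mathcal{D})$ is the spectral radius of $A_{\mathcal{D}}$ restricted to $L^2_0$. A matrix is $r$-normal if it is unitarily equivalent to a block-diagonal matrix with blocks of size at most $r\times r$; a digraph is $r$-normal if its adjacency matrix is; a family is almost-normal if all its members are $r$-normal for one fixed $r<\infty$. *)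

theory Defs
  imports
    "Graph_Theory.Graph_Theory"
    "Jordan_Normal_Form.Schur_Decomposition"
    "HOL-Library.Disjoint_Sets"
    "HOL-Library.Indicator_Function"
    Complex_Main
begin

definition regular_digraph :: "nat \<Rightarrow> ('a, 'b) pre_digraph \<Rightarrow> bool" where
  "regular_digraph k G \<longleftrightarrow> (\<forall>v \<in> verts G. out_degree G v = k \<and> in_degree G v = k)"

text \<open>
  Matrices are indexed by initial segments of the naturals, so the vertices are enumerated by an
  arbitrary fixed list. Another enumeration conjugates the adjacency matrix by a permutation
  matrix, which affects none of the notions below.
\<close>

definition vertex_list :: "('a, 'b) pre_digraph \<Rightarrow> 'a list" where
  "vertex_list G = (SOME vs. distinct vs \<and> set vs = verts G)"

definition adjacency_matrix :: "('a, 'b) pre_digraph \<Rightarrow> complex mat" where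
  "adjacency_matrix G =
     mat (card (verts G)) (card (verts G))
       (\<lambda>(i, j). of_nat (card {e \<in> arcs G. tail G e = vertex_list G ! i \<and>
                                           head G e = vertex_list G ! j}))"

definition cyclic_partition :: "('a, 'b) pre_digraph \<Rightarrow> nat \<Rightarrow> (nat \<Rightarrow> 'a set) \<Rightarrow> bool" where
  "cyclic_partition G m V \<longleftrightarrow>
     disjoint_family_on V {..<m} \<and> (\<Union>j<m. V j) = verts G \<and>
     (\<forall>e \<in> arcs G. \<forall>j<m. tail G e \<in> V j \<longrightarrow> head G e \<in> V ((j + 1) mod m))"

definition periodic :: "nat \<Rightarrow> ('a, 'b) pre_digraph \<Rightarrow> bool" where
  "periodic m G \<longleftrightarrow>
     (\<exists>V. cyclic_partition G m V) \<and> (\<forall>m'. (\<exists>V. cyclic_partition G m' V) \<longrightarrow> m' \<le> m)"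

definition period :: "('a, 'b) pre_digraph \<Rightarrow> nat" where
  "period G = (THE m. periodic m G)"

definition trivial_eigenfunction ::
    "('a, 'b) pre_digraph \<Rightarrow> (nat \<Rightarrow> 'a set) \<Rightarrow> nat \<Rightarrow> complex vec" where
  "trivial_eigenfunction G V t =
     vec (card (verts G))
       (\<lambda>i. \<Sum>j<period G. cis (2 * pi * real j * real t / real (period G)) *
                          indicator (V j) (vertex_list G ! i))"

text \<open>
  In a connected digraph the partition into \<open>period G\<close> classes is unique up to a cyclic shift,
  which only multiplies the trivial eigenfunctions by scalars; hence quantifying over all such
  partitions is the same as fixing one.
\<close>

definition L2_0 :: "('a, 'b) pre_digraph \<Rightarrow> complex vec set" where
  "L2_0 G = {f \<in> carrier_vec (card (verts G)).
     \<forall>V t. cyclic_partition G (period G) V \<and> t < period G \<longrightarrow>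
       f \<bullet>c trivial_eigenfunction G V t = 0}"

text \<open>
  The subspace \<open>L2_0 G\<close> is invariant under the adjacency matrix of a regular digraph. The element
  0 is inserted so that the spectral radius is 0 when \<open>L2_0 G\<close> is the zero space.
\<close>

definition rho :: "('a, 'b) pre_digraph \<Rightarrow> real" where
  "rho G = Max (insert 0 {cmod c | c. \<exists>f \<in> L2_0 G. eigenvector (adjacency_matrix G) f c})"

text \<open>\<open>similar_mat_wit A B U (mat_adjoint U)\<close> contains that \<open>U\<close> is unitary.\<close>

definition unitarily_equivalent :: "complex mat \<Rightarrow> complex mat \<Rightarrow> bool" where
  "unitarily_equivalent A B \<longleftrightarrow> (\<exists>U. similar_mat_wit A B U (mat_adjoint U))"

definition r_normal_mat :: "nat \<Rightarrow> complex mat \<Rightarrow> bool" where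
  "r_normal_mat r A \<longleftrightarrow>
     (\<exists>Bs. (\<forall>B \<in> set Bs. square_mat B \<and> dim_row B \<le> r) \<and>
           unitarily_equivalent A (diag_block_mat Bs))"

definition r_normal :: "nat \<Rightarrow> ('a, 'b) pre_digraph \<Rightarrow> bool" where
  "r_normal r G \<longleftrightarrow> r_normal_mat r (adjacency_matrix G)"

definition almost_normal :: "('a, 'b) pre_digraph set \<Rightarrow> bool" where
  "almost_normal F \<longleftrightarrow> (\<exists>r. \<forall>G \<in> F. r_normal r G)"

definition iso_rel :: "('a, 'b) pre_digraph rel" where
  "iso_rel = {(G, H). digraph_iso G H}"

end

theory Submission
  imports Defs
begin

text \<open>
  Let \<open>A\<close> be the adjacency matrix of a digraph with \<open>n\<close> vertices. The entries of \<open>A\<^sup>l\<close> are natural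
  numbers with row sums \<open>k\<^sup>l\<close>, so the squared Frobenius norm of \<open>A\<^sup>l\<close> is at least \<open>n k\<^sup>l\<close>. It is also the sum
  of the squared Frobenius norms of the \<open>l\<close>-th powers of the unitary blocks, whose entries are bounded by
  \<open>k\<close>. The eigenvectors of \<open>A\<close> for eigenvalues other than the \<open>m\<close> trivial ones lie in \<open>L\<^sup>2\<^sub>0\<close>. If two blocks had
  the same trivial eigenvalue, some combination of their eigenvectors would be orthogonal to the
  trivial eigenfunction and hence lie in \<open>L\<^sup>2\<^sub>0\<close>, which the bound on \<open>\<rho>\<close> excludes. So at most \<open>m\<close> blocks have a
  trivial eigenvalue, and each of the others contributes at most \<open>C \<mu>\<^sup>2\<^sup>l\<close> with \<open>\<mu> < \<surd>k\<close>, where \<open>C\<close> and \<open>\<mu>\<close> depend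
  only on \<open>k\<close>, \<open>r\<close> and \<open>\<epsilon>\<close>. Fixing \<open>l\<close> with \<open>C \<mu>\<^sup>2\<^sup>l \<le> k\<^sup>l / 2\<close> bounds \<open>n\<close>.
\<close>

section \<open>Norms of complex matrices\<close>

definition frobenius_sq :: "complex mat \<Rightarrow> real" where
  "frobenius_sq M = (\<Sum>i<dim_row M. \<Sum>j<dim_col M. (cmod (M $$ (i, j)))\<^sup>2)"

text \<open>The entrywise sum norm is submultiplicative and dominates the Frobenius norm. Its loss
  against an operator norm depends only on the matrix size, which is harmless for blocks of size at
  most \<open>r\<close>.\<close>

definition l1_norm :: "complex mat \<Rightarrow> real" where
  "l1_norm M = (\<Sum>i<dim_row M. \<Sum>j<dim_col M. cmod (M $$ (i, j)))"

lemma l1_norm_nonneg: "0 \<le> l1_norm M"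
  unfolding l1_norm_def by (intro sum_nonneg) auto

lemma index_mult_mat_sum:
  assumes "A \<in> carrier_mat n p" "B \<in> carrier_mat p q" "i < n" "j < q"
  shows "(A * B) $$ (i, j) = (\<Sum>l<p. A $$ (i, l) * B $$ (l, j))"
  using assms by (auto simp: scalar_prod_def atLeast0LessThan)

lemma l1_norm_mult:
  assumes "A \<in> carrier_mat n n" "B \<in> carrier_mat n n"
  shows "l1_norm (A * B) \<le> l1_norm A * l1_norm B"
proof -
  have "l1_norm (A * B) = (\<Sum>i<n. \<Sum>j<n. cmod (\<Sum>l<n. A $$ (i, l) * B $$ (l, j)))"
    using assms unfolding l1_norm_def
    by (auto simp: index_mult_mat_sum[OF assms] simp del: index_mult_mat(1) intro!: sum.cong)
  also have "\<dots> \<le> (\<Sum>i<n. \<Sum>j<n. \<Sum>l<n. cmod (A $$ (i, l)) * cmod (B $$ (l, j)))"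
    by (intro sum_mono order_trans[OF norm_sum] eq_refl) (simp add: norm_mult)
  also have "\<dots> = (\<Sum>i<n. \<Sum>l<n. cmod (A $$ (i, l)) * (\<Sum>j<n. cmod (B $$ (l, j))))"
    by (subst sum.swap) (simp add: sum_distrib_left)
  also have "\<dots> \<le> (\<Sum>i<n. \<Sum>l<n. cmod (A $$ (i, l)) * (\<Sum>l<n. \<Sum>j<n. cmod (B $$ (l, j))))"
    by (intro sum_mono mult_left_mono member_le_sum sum_nonneg) auto
  also have "\<dots> = l1_norm A * l1_norm B"
    using assms unfolding l1_norm_def by (auto simp: sum_distrib_right)
  finally show ?thesis .
qed

lemma l1_norm_add:
  assumes "A \<in> carrier_mat n p" "B \<in> carrier_mat n p"
  shows "l1_norm (A + B) \<le> l1_norm A + l1_norm B"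
proof -
  have "l1_norm (A + B) \<le> (\<Sum>i<n. \<Sum>j<p. cmod (A $$ (i, j)) + cmod (B $$ (i, j)))"
    using assms unfolding l1_norm_def index_add_mat carrier_matD[OF assms(2)]
    by (intro sum_mono) (auto intro: norm_triangle_ineq)
  also have "\<dots> = l1_norm A + l1_norm B"
    using assms unfolding l1_norm_def by (simp add: sum.distrib)
  finally show ?thesis .
qed

lemma l1_norm_smult: "l1_norm (c \<cdot>\<^sub>m A) = cmod c * l1_norm A"
  unfolding l1_norm_def by (auto simp: sum_distrib_left norm_mult intro!: sum.cong)

lemma l1_norm_one: "l1_norm (1\<^sub>m n) = real n"
proof -
  have "l1_norm (1\<^sub>m n) = (\<Sum>i<n. \<Sum>j<n. if j = i then 1 else (0::real))"
    unfolding l1_norm_def index_one_mat by (intro sum.cong refl) (simp split: if_splits)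
  then show ?thesis by simp
qed

lemma l1_norm_zero: "l1_norm (0\<^sub>m n p) = 0"
  unfolding l1_norm_def by simp

lemma l1_norm_le_entries:
  assumes "A \<in> carrier_mat n n" "\<And>i j. i < n \<Longrightarrow> j < n \<Longrightarrow> cmod (A $$ (i, j)) \<le> b"
  shows "l1_norm A \<le> real n * (real n * b)"
proof -
  have "l1_norm A \<le> (\<Sum>i<n. \<Sum>j<n. b)"
    unfolding l1_norm_def carrier_matD[OF assms(1)] by (intro sum_mono assms(2)) auto
  then show ?thesis by simp
qed

text \<open>The factor \<open>real n\<close> is the norm of the identity, reached at exponent
  0.\<close>

lemma l1_norm_pow:
  assumes "A \<in> carrier_mat n n"
  shows "l1_norm (A ^\<^sub>m l) \<le> real n * l1_norm A ^ l"
proof (induction l)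
  case 0
  then show ?case using assms by (simp add: l1_norm_one)
next
  case (Suc l)
  have "l1_norm (A ^\<^sub>m Suc l) \<le> l1_norm (A ^\<^sub>m l) * l1_norm A"
    using l1_norm_mult[OF pow_carrier_mat[OF assms, of l] assms] by simp
  also have "\<dots> \<le> real n * l1_norm A ^ l * l1_norm A"
    by (intro mult_right_mono Suc l1_norm_nonneg)
  finally show ?case by (simp add: mult_ac)
qed

lemma frobenius_sq_le_l1_norm: "frobenius_sq M \<le> (l1_norm M)\<^sup>2"
proof -
  have *: "cmod (M $$ (i, j)) \<le> l1_norm M" if "i < dim_row M" "j < dim_col M" for i j
  proof -
    have "cmod (M $$ (i, j)) \<le> (\<Sum>j<dim_col M. cmod (M $$ (i, j)))"
      using that by (intro member_le_sum) auto
    also have "\<dots> \<le> l1_norm M"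
      unfolding l1_norm_def using that
      by (intro member_le_sum[where f = "\<lambda>i. \<Sum>j<dim_col M. cmod (M $$ (i, j))"])
         (auto intro!: sum_nonneg)
    finally show ?thesis .
  qed
  have "frobenius_sq M \<le> (\<Sum>i<dim_row M. \<Sum>j<dim_col M. cmod (M $$ (i, j)) * l1_norm M)"
    unfolding frobenius_sq_def power2_eq_square using *
    by (intro sum_mono mult_left_mono) auto
  also have "\<dots> = (l1_norm M)\<^sup>2"
    unfolding l1_norm_def power2_eq_square by (simp add: sum_distrib_right)
  finally show ?thesis .
qed

section \<open>Unitary invariance and block additivity of the Frobenius norm\<close>

lemma frobenius_sq_transpose: "frobenius_sq (transpose_mat M) = frobenius_sq M"
  unfolding frobenius_sq_def by (subst sum.swap) simp

text \<open>A matrix with orthonormal columns preserves the Euclidean norm of each column of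
  \<open>M\<close>; expanding the squares and summing over the row index first leaves only the
  diagonal terms \<open>a = b\<close>.\<close>

lemma frobenius_sq_isometry_mult:
  assumes P: "P \<in> carrier_mat n n" and M: "M \<in> carrier_mat n n"
    and orth: "\<And>a b. a < n \<Longrightarrow> b < n \<Longrightarrow>
      (\<Sum>i<n. P $$ (i, a) * cnj (P $$ (i, b))) = (if a = b then 1 else 0)"
  shows "frobenius_sq (P * M) = frobenius_sq M"
proof -
  have col: "(\<Sum>i<n. (cmod (\<Sum>a<n. P $$ (i, a) * x a))\<^sup>2) = (\<Sum>a<n. (cmod (x a))\<^sup>2)" for x
  proof -
    have "complex_of_real (\<Sum>i<n. (cmod (\<Sum>a<n. P $$ (i, a) * x a))\<^sup>2)
       = (\<Sum>i<n. (\<Sum>a<n. P $$ (i, a) * x a) * cnj (\<Sum>a<n. P $$ (i, a) * x a))"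
      by (simp only: of_real_sum complex_norm_square)
    also have "\<dots> = (\<Sum>i<n. \<Sum>a<n. \<Sum>b<n. x a * cnj (x b) * (P $$ (i, a) * cnj (P $$ (i, b))))"
      by (simp add: sum_product mult_ac)
    also have "\<dots> = (\<Sum>a<n. \<Sum>i<n. \<Sum>b<n. x a * cnj (x b) * (P $$ (i, a) * cnj (P $$ (i, b))))"
      by (rule sum.swap)
    also have "\<dots> = (\<Sum>a<n. \<Sum>b<n. \<Sum>i<n. x a * cnj (x b) * (P $$ (i, a) * cnj (P $$ (i, b))))"
      by (intro sum.cong refl sum.swap)
    also have "\<dots> = (\<Sum>a<n. \<Sum>b<n. if b = a then x a * cnj (x b) else 0)"
      by (intro sum.cong refl) (simp add: sum_distrib_left[symmetric] orth)
    also have "\<dots> = complex_of_real (\<Sum>a<n. (cmod (x a))\<^sup>2)"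
      by (simp only: of_real_sum complex_norm_square) simp
    finally show ?thesis by (simp only: of_real_eq_iff)
  qed
  have "frobenius_sq (P * M) = (\<Sum>j<n. \<Sum>i<n. (cmod (\<Sum>a<n. P $$ (i, a) * M $$ (a, j)))\<^sup>2)"
    using P M unfolding frobenius_sq_def
    by (subst sum.swap) (auto simp: index_mult_mat_sum[OF P M] simp del: index_mult_mat(1) intro!: sum.cong)
  also have "\<dots> = (\<Sum>j<n. \<Sum>i<n. (cmod (M $$ (i, j)))\<^sup>2)"
    by (simp add: col)
  also have "\<dots> = frobenius_sq M"
    using M unfolding frobenius_sq_def by (subst sum.swap) auto
  finally show ?thesis .
qed

lemma mat_adjoint_index:
  assumes "U \<in> carrier_mat n p" "i < p" "j < n"
  shows "mat_adjoint U $$ (i, j) = cnj (U $$ (j, i))"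
  using assms unfolding mat_adjoint_def by (auto simp: mat_of_rows_def)

lemma mat_adjoint_carrier:
  assumes "U \<in> carrier_mat n p"
  shows "mat_adjoint U \<in> carrier_mat p n"
  using assms unfolding mat_adjoint_def carrier_mat_def by (auto simp: mat_of_rows_def)

lemma unitary_columns:
  assumes U: "U \<in> carrier_mat n n" and one: "mat_adjoint U * U = 1\<^sub>m n" and "a < n" "b < n"
  shows "(\<Sum>i<n. U $$ (i, a) * cnj (U $$ (i, b))) = (if a = b then 1 else 0)"
proof -
  have "(\<Sum>i<n. U $$ (i, a) * cnj (U $$ (i, b))) = (mat_adjoint U * U) $$ (b, a)"
    using assms
    by (subst index_mult_mat_sum[OF mat_adjoint_carrier[OF U] U])
       (auto simp: mat_adjoint_index[OF U] mult_ac)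
  then show ?thesis using assms by auto
qed

lemma frobenius_sq_unitarily_equivalent:
  assumes wit: "similar_mat_wit A B U (mat_adjoint U)"
  shows "frobenius_sq A = frobenius_sq B"
proof -
  define n where "n = dim_row A"
  note w = similar_mat_witD[OF n_def wit]
  have U: "U \<in> carrier_mat n n" and B: "B \<in> carrier_mat n n" using w by auto
  note orth = unitary_columns[OF U w(2)]
  \<comment> \<open>Right multiplication by the adjoint becomes, after transposing, left
    multiplication by the entrywise conjugate of \<open>U\<close>, whose columns are again
    orthonormal.\<close>
  have AU: "transpose_mat (mat_adjoint U) \<in> carrier_mat n n"
    using mat_adjoint_carrier[OF U] by simp
  have orth': "(\<Sum>i<n. transpose_mat (mat_adjoint U) $$ (i, a) * cnj (transpose_mat (mat_adjoint U) $$ (i, b)))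
      = (if a = b then 1 else 0)" if "a < n" "b < n" for a b
    using orth[OF that(2,1)] that mat_adjoint_carrier[OF U]
    by (auto simp: mat_adjoint_index[OF U] mult_ac)
  have "frobenius_sq A = frobenius_sq (U * (B * mat_adjoint U))"
    using w by (simp add: assoc_mult_mat[of _ n n _ n _ n])
  also have "\<dots> = frobenius_sq (B * mat_adjoint U)"
    using w by (intro frobenius_sq_isometry_mult[OF U _ orth]) auto
  also have "\<dots> = frobenius_sq (transpose_mat (mat_adjoint U) * transpose_mat B)"
    using transpose_mult[OF B w(7)] frobenius_sq_transpose[of "B * mat_adjoint U"] by simp
  also have "\<dots> = frobenius_sq (transpose_mat B)"
    using B by (intro frobenius_sq_isometry_mult[OF AU _ orth']) auto
  finally show ?thesis by (simp add: frobenius_sq_transpose)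
qed

lemma frobenius_sq_diag_block_mat: "frobenius_sq (diag_block_mat Bs) = (\<Sum>B\<leftarrow>Bs. frobenius_sq B)"
proof (induction Bs)
  case Nil
  then show ?case by (simp add: frobenius_sq_def)
next
  case (Cons B Bs)
  define D where "D = diag_block_mat Bs"
  define p q s t where "p = dim_row B" and "q = dim_col B" and "s = dim_row D" and "t = dim_col D"
  note d = p_def[symmetric] q_def[symmetric] s_def[symmetric] t_def[symmetric]
  have split: "(\<Sum>i<a + b. f i) = (\<Sum>i<a. f i) + (\<Sum>i<b. f (i + a))" for a b :: nat and f :: "nat \<Rightarrow> real"

    by (induction b) (auto simp: add_ac)
  have "frobenius_sq (diag_block_mat (B # Bs)) = (\<Sum>i<p + s. \<Sum>j<q + t. (cmod
      (if i < p then if j < q then B $$ (i, j) else 0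
       else if j < q then 0 else D $$ (i - p, j - q)))\<^sup>2)"
    unfolding frobenius_sq_def by (auto simp: Let_def D_def[symmetric] d intro!: sum.cong)
  also have "\<dots> = frobenius_sq B + frobenius_sq D"
    unfolding split frobenius_sq_def d by simp
  finally show ?case using Cons by (simp add: D_def)
qed

section \<open>Powers of matrices with small spectral radius\<close>

text \<open>
  The factors \<open>A - e\<close> are taken from the last \<open>e\<close> backwards: for upper triangular \<open>A\<close> with diagonal \<open>es\<close> each
  further factor on the left then annihilates one more row.
\<close>

fun shift_prod :: "complex mat \<Rightarrow> complex list \<Rightarrow> nat \<Rightarrow> complex mat" where
  "shift_prod A es 0 = 1\<^sub>m (dim_row A)"
| "shift_prod A es (Suc j) =
     (A + (- es ! (length es - Suc j)) \<cdot>\<^sub>m 1\<^sub>m (dim_row A)) * shift_prod A es j"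

lemma shift_prod_carrier [simp]:
  assumes "A \<in> carrier_mat n n"
  shows "shift_prod A es j \<in> carrier_mat n n"
  by (induction j) (use assms in auto)

text \<open>Each factor \<open>A - e\<close> is conjugate to \<open>T - e\<close>, and the inner
  \<open>Q * P = 1\<close> cancels between neighbouring factors. This reduces the vanishing of the
  full product to the triangular case.\<close>

lemma shift_prod_similar:
  assumes wit: "similar_mat_wit A T P Q" and A: "A \<in> carrier_mat n n"
  shows "shift_prod A es j = P * shift_prod T es j * Q"
proof (induction j)
  case 0
  then show ?case using similar_mat_witD2[OF A wit] by auto
next
  case (Suc j)
  note w = similar_mat_witD2[OF A wit]
  let ?e = "- es ! (length es - Suc j)"
  let ?S = "shift_prod T es j"
  have S: "?S \<in> carrier_mat n n" using w by auto
  have 1: "A + ?e \<cdot>\<^sub>m 1\<^sub>m n = P * (T + ?e \<cdot>\<^sub>m 1\<^sub>m n) * Q"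
  proof -
    have "P * (T + ?e \<cdot>\<^sub>m 1\<^sub>m n) * Q = P * T * Q + P * (?e \<cdot>\<^sub>m 1\<^sub>m n) * Q"
      using w by (simp add: mult_add_distrib_mat[of _ n n _ n] add_mult_distrib_mat[of _ n n _ _ n])
    also have "P * (?e \<cdot>\<^sub>m 1\<^sub>m n) * Q = ?e \<cdot>\<^sub>m 1\<^sub>m n"
      using w by (simp add: mult_smult_distrib[of _ n n _ n] mult_smult_assoc_mat[of _ n n _ n])
    finally show ?thesis using w by simp
  qed
  have "shift_prod A es (Suc j) = (P * (T + ?e \<cdot>\<^sub>m 1\<^sub>m n) * Q) * (P * ?S * Q)"
    using A Suc 1 by simp
  also have "\<dots> = P * ((T + ?e \<cdot>\<^sub>m 1\<^sub>m n) * ?S) * Q"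
  proof -
    have "(P * M * Q) * (P * S * Q) = P * (M * S) * Q"
      if M: "M \<in> carrier_mat n n" and S: "S \<in> carrier_mat n n" for M S
    proof -
      have "(P * M * Q) * (P * S * Q) = P * M * (Q * P) * S * Q"
        using w(6,7) M S by (simp add: assoc_mult_mat[of _ n n _ n _ n])
      also have "\<dots> = P * (M * S) * Q"
        unfolding w(2) using w(6,7) M S by (simp add: assoc_mult_mat[of _ n n _ n _ n])
      finally show ?thesis .
    qed
    then show ?thesis using w(5) S by simp
  qed
  finally show ?case using w by simp
qed

lemma shift_prod_upper_triangular:
  assumes T: "T \<in> carrier_mat n n" and tri: "upper_triangular T" and "diag_mat T = es"
    and "j \<le> n" "n - j \<le> i" "i < n" "l < n"
  shows "shift_prod T es j $$ (i, l) = 0"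
  using assms(4-)
proof (induction j arbitrary: i)
  case 0
  then show ?case by auto
next
  case (Suc j)
  have len: "length es = n" using assms by (auto simp: diag_mat_def)
  let ?e = "es ! (n - Suc j)"
  let ?M = "T + (- ?e) \<cdot>\<^sub>m 1\<^sub>m n"
  have M: "?M \<in> carrier_mat n n" using T by auto
  have e: "?e = T $$ (n - Suc j, n - Suc j)"
    using Suc.prems T assms(3)[symmetric] by (auto simp: diag_mat_def)
  have "shift_prod T es (Suc j) $$ (i, l) = (?M * shift_prod T es j) $$ (i, l)"
    using T len by simp
  also have "\<dots> = (\<Sum>a<n. ?M $$ (i, a) * shift_prod T es j $$ (a, l))"
    using Suc.prems T by (subst index_mult_mat_sum[OF M shift_prod_carrier[OF T]]) auto
  also have "\<dots> = 0"
  proof (intro sum.neutral ballI)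
    fix a assume "a \<in> {..<n}"
    then have a: "a < n" by simp
    \<comment> \<open>The three reasons for a term to vanish: row \<open>a\<close> of the shorter
      product is already zero, the entry lies below the diagonal, or it is the diagonal entry that
      the shift cancels.\<close>
    consider "n - j \<le> a" | "a < i" | "a = i" "i = n - Suc j"
      using Suc.prems by linarith
    then show "?M $$ (i, a) * shift_prod T es j $$ (a, l) = 0"
    proof cases
      case 1
      then show ?thesis using Suc.IH[of a] a Suc.prems by simp
    next
      case 2
      then show ?thesis using a Suc.prems T upper_triangularD[OF tri, of a i] by simp
    next
      case 3
      then show ?thesis using a Suc.prems T e by simp
    qed
  qed
  finally show ?case .
qed

text \<open>Cayley-Hamilton in factored form: Schur triangularisation puts the eigenvalues on the
  diagonal in the order of \<open>es\<close>, and after \<open>n\<close> factors all rows are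
  zero.\<close>

lemma shift_prod_char_poly_eq_0:
  assumes A: "A \<in> carrier_mat n n" and c: "char_poly A = (\<Prod>e\<leftarrow>es. [:- e, 1:])"
  shows "shift_prod A es n = 0\<^sub>m n n"
proof -
  obtain T P Q where "schur_decomposition A es = (T, P, Q)"
    using prod_cases3 by blast
  then have s: "similar_mat_wit A T P Q" "upper_triangular T" "diag_mat T = es"
    using schur_decomposition[OF A c] by auto
  note w = similar_mat_witD2[OF A s(1)]
  have "shift_prod T es n = 0\<^sub>m n n"
    using w by (intro eq_matI) (auto simp: shift_prod_upper_triangular[OF w(5) s(2,3), of n] carrier_matD[OF shift_prod_carrier])
  then show ?thesis
    using w(6,7) by (simp add: shift_prod_similar[OF s(1) A])
qed

text \<open>
  Writing \<open>Q\<^sub>j\<close> for the product of \<open>j\<close> of the factors \<open>B - e\<close>, the identity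
  \<open>B\<^sup>l\<^sup>+\<^sup>1 Q\<^sub>j = B\<^sup>l Q\<^sub>j\<^sub>+\<^sub>1 + e B\<^sup>l Q\<^sub>j\<close> together with \<open>Q\<^sub>n = 0\<close> bounds the powers of \<open>B\<close> by a constant
  depending on a norm of \<open>B\<close>, but not on the angles between its eigenvectors.
\<close>

lemma l1_norm_pow_le_spectral:
  assumes B: "B \<in> carrier_mat n n" and n: "n \<le> r"
    and eig: "\<And>e. eigenvalue B e \<Longrightarrow> cmod e \<le> \<sigma>"
    and \<sigma>: "0 \<le> \<sigma>" and W: "0 < W" "W \<le> 1"
    and c: "l1_norm B + \<sigma> * real r \<le> c" "1 \<le> c"
  shows "l1_norm (B ^\<^sub>m l) \<le> real r * (c / W) ^ r * (\<sigma> + W) ^ l"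
proof -
  obtain es where es: "char_poly B = (\<Prod>e\<leftarrow>es. [:- e, 1:])" "length es = n"
    using char_poly_factorized[OF B] by blast
  have es_le: "cmod (es ! i) \<le> \<sigma>" if "i < n" for i
  proof -
    have "poly (char_poly B) (es ! i) = 0"
      unfolding es(1) poly_prod_list using that es(2) by (auto simp: prod_list_zero_iff)
    then show ?thesis using eig eigenvalue_root_char_poly[OF B] by blast
  qed
  let ?Q = "shift_prod B es"
  define K where "K = real r * (c / W) ^ r"
  have K: "0 \<le> K" unfolding K_def using W c by simp
  have Q0: "l1_norm (?Q j) \<le> real r * c ^ j" if "j \<le> n" for j
    using that
  proof (induction j)
    case 0
    then show ?case using B n by (simp add: l1_norm_one)
  next
    case (Suc j)
    let ?M = "B + (- es ! (n - Suc j)) \<cdot>\<^sub>m 1\<^sub>m n"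
    have M: "?M \<in> carrier_mat n n" using B by simp
    have "l1_norm ?M \<le> l1_norm B + cmod (es ! (n - Suc j)) * real n"
      using l1_norm_add[OF B, of "(- es ! (n - Suc j)) \<cdot>\<^sub>m 1\<^sub>m n"] by (simp add: l1_norm_smult l1_norm_one)
    also have "\<dots> \<le> l1_norm B + \<sigma> * real r"
      using es_le[of "n - Suc j"] Suc.prems n \<sigma> by (intro add_left_mono mult_mono) auto
    finally have "l1_norm ?M \<le> c" using c by simp
    then have "l1_norm ?M * l1_norm (?Q j) \<le> c * (real r * c ^ j)"
      using Suc c by (intro mult_mono) (auto simp: l1_norm_nonneg)
    then show ?case
      using l1_norm_mult[OF M shift_prod_carrier[OF B, of es j]] B es(2) by (simp add: mult_ac)
  qed
  \<comment> \<open>The weight \<open>W ^ j\<close> closes the induction: the term with one more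
    factor contributes \<open>W\<close> and the term with \<open>e\<close> at most
    \<open>\<sigma>\<close>, so together they give one more power of
    \<open>\<sigma> + W\<close>.\<close>
  have "l1_norm (B ^\<^sub>m l * ?Q j) \<le> K * W ^ j * (\<sigma> + W) ^ l" if "j \<le> n" for j l
    using that
  proof (induction l arbitrary: j)
    case 0
    have "l1_norm (B ^\<^sub>m 0 * ?Q j) \<le> real r * c ^ j"
      using Q0[OF 0] B by (simp add: left_mult_one_mat[OF shift_prod_carrier[OF B]])
    \<comment> \<open>The constant is made uniform in the size: \<open>1 \<le> c\<close> raises the
      exponent of \<open>c\<close> to \<open>r\<close>, and \<open>W \<le> 1\<close> later lowers
      that of \<open>W\<close> from \<open>r\<close> to \<open>j\<close>.\<close>
    also have "\<dots> \<le> real r * c ^ r"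
      using 0 n c by (intro mult_left_mono power_increasing) auto
    also have "\<dots> = K * W ^ r"
      unfolding K_def using W by (simp add: power_divide)
    also have "\<dots> \<le> K * W ^ j"
      using 0 n W K by (intro mult_left_mono power_decreasing) auto
    finally show ?case by simp
  next
    case (Suc l)
    note [simp] = shift_prod_carrier[OF B] pow_carrier_mat[OF B]
    show ?case
    proof (cases "j = n")
      case True
      have "l1_norm (B ^\<^sub>m Suc l * ?Q j) = 0"
        using True B shift_prod_char_poly_eq_0[OF B es(1)]
        by (simp add: l1_norm_zero right_mult_zero_mat[of _ n n])
      then show ?thesis using K W \<sigma> by simp
    next
      case False
      then have j: "j < n" using Suc.prems by simp
      let ?e = "es ! (n - Suc j)"
      have "?Q (Suc j) = B * ?Q j + (- ?e) \<cdot>\<^sub>m ?Q j"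
        using B es(2) by (simp add: add_mult_distrib_mat[of _ n n _ _ n] mult_smult_assoc_mat[of _ n n _ n]
            left_mult_one_mat[OF shift_prod_carrier[OF B]])
      then have "B * ?Q j = ?Q (Suc j) + ?e \<cdot>\<^sub>m ?Q j"
        using B carrier_matD[OF shift_prod_carrier[OF B, of es j]]
        by (auto intro!: eq_matI simp del: shift_prod.simps index_mult_mat(1))
      then have "B ^\<^sub>m Suc l * ?Q j = B ^\<^sub>m l * (?Q (Suc j) + ?e \<cdot>\<^sub>m ?Q j)"
        using B by (simp add: assoc_mult_mat[of _ n n _ n _ n] del: shift_prod.simps)
      also have "\<dots> = B ^\<^sub>m l * ?Q (Suc j) + ?e \<cdot>\<^sub>m (B ^\<^sub>m l * ?Q j)"
        using B by (simp add: mult_add_distrib_mat[of _ n n _ n] mult_smult_distrib[of _ n n _ n] del: shift_prod.simps)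
      finally have eq: "B ^\<^sub>m Suc l * ?Q j = B ^\<^sub>m l * ?Q (Suc j) + ?e \<cdot>\<^sub>m (B ^\<^sub>m l * ?Q j)" .
      have "l1_norm (B ^\<^sub>m Suc l * ?Q j) \<le> l1_norm (B ^\<^sub>m l * ?Q (Suc j)) + cmod ?e * l1_norm (B ^\<^sub>m l * ?Q j)"
        unfolding eq l1_norm_smult[symmetric]
        by (intro l1_norm_add[of _ n n] smult_carrier_mat mult_carrier_mat[of _ n n]
              shift_prod_carrier pow_carrier_mat B)
      also have "\<dots> \<le> K * W ^ Suc j * (\<sigma> + W) ^ l + \<sigma> * (K * W ^ j * (\<sigma> + W) ^ l)"
        using Suc.IH[of "Suc j"] Suc.IH[of j] j es_le[of "n - Suc j"] \<sigma>
        by (intro add_mono mult_mono) (auto simp: l1_norm_nonneg)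
      also have "\<dots> = K * W ^ j * (\<sigma> + W) ^ Suc l"
        by (simp add: algebra_simps)
      finally show ?thesis .
    qed
  qed
  from this[of 0 l] show ?thesis
    using B pow_carrier_mat[OF B, of l] by (simp add: K_def)
qed

section \<open>Block-diagonal matrices\<close>

lemma append_vec_eq_zero_iff:
  fixes u v :: "'a :: zero vec"
  assumes "u \<in> carrier_vec p" "v \<in> carrier_vec q"
  shows "u @\<^sub>v v = 0\<^sub>v (p + q) \<longleftrightarrow> u = 0\<^sub>v p \<and> v = 0\<^sub>v q"
proof -
  have "(0\<^sub>v (p + q) :: 'a vec) = 0\<^sub>v p @\<^sub>v 0\<^sub>v q" by auto
  then show ?thesis by (simp only: append_vec_eq[OF assms(1) zero_carrier_vec])
qed

lemma smult_append_vec: "a \<cdot>\<^sub>v (u @\<^sub>v v) = (a \<cdot>\<^sub>v u) @\<^sub>v (a \<cdot>\<^sub>v v)"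
  by (intro eq_vecI) auto

text \<open>Only one of the two parts has to be nonzero, so this covers both zero padding and
  combinations of eigenvectors of the two blocks.\<close>

lemma eigenvector_four_block_diag:
  assumes B: "B \<in> carrier_mat p p" and D: "D \<in> carrier_mat q q"
    and u: "u \<in> carrier_vec p" "B *\<^sub>v u = e \<cdot>\<^sub>v u"
    and v: "v \<in> carrier_vec q" "D *\<^sub>v v = e \<cdot>\<^sub>v v"
    and "u \<noteq> 0\<^sub>v p \<or> v \<noteq> 0\<^sub>v q"
  shows "eigenvector (four_block_mat B (0\<^sub>m p q) (0\<^sub>m q p) D) (u @\<^sub>v v) e"
  using assms append_vec_eq_zero_iff[OF u(1) v(1)] mult_mat_vec_split[OF B D u(1) v(1)]
  by (auto simp: eigenvector_def smult_append_vec)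

lemma eigenvector_four_block_left:
  assumes "B \<in> carrier_mat p p" "D \<in> carrier_mat q q" "eigenvector B v e"
  shows "eigenvector (four_block_mat B (0\<^sub>m p q) (0\<^sub>m q p) D) (v @\<^sub>v 0\<^sub>v q) e"
proof -
  have "D *\<^sub>v 0\<^sub>v q = e \<cdot>\<^sub>v 0\<^sub>v q" using assms by (intro eq_vecI) auto
  then show ?thesis
    using assms by (intro eigenvector_four_block_diag) (auto simp: eigenvector_def)
qed

lemma eigenvector_four_block_right:
  assumes "B \<in> carrier_mat p p" "D \<in> carrier_mat q q" "eigenvector D v e"
  shows "eigenvector (four_block_mat B (0\<^sub>m p q) (0\<^sub>m q p) D) (0\<^sub>v p @\<^sub>v v) e"
proof -
  have "B *\<^sub>v 0\<^sub>v p = e \<cdot>\<^sub>v 0\<^sub>v p" using assms by (intro eq_vecI) auto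
  then show ?thesis
    using assms by (intro eigenvector_four_block_diag) (auto simp: eigenvector_def)
qed

lemma diag_block_mat_Cons_square:
  assumes "square_mat B" "\<forall>B \<in> set Bs. square_mat B"
  obtains p q where "B \<in> carrier_mat p p" "diag_block_mat Bs \<in> carrier_mat q q"
    "diag_block_mat (B # Bs) = four_block_mat B (0\<^sub>m p q) (0\<^sub>m q p) (diag_block_mat Bs)"
proof
  show B: "B \<in> carrier_mat (dim_row B) (dim_row B)"
    and D: "diag_block_mat Bs \<in> carrier_mat (dim_row (diag_block_mat Bs)) (dim_row (diag_block_mat Bs))"
    using assms diag_block_mat_square[of Bs] by auto
  show "diag_block_mat (B # Bs) = four_block_mat B (0\<^sub>m (dim_row B) (dim_row (diag_block_mat Bs)))
      (0\<^sub>m (dim_row (diag_block_mat Bs)) (dim_row B)) (diag_block_mat Bs)"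
    unfolding diag_block_mat.simps Let_def carrier_matD(2)[OF B] carrier_matD(2)[OF D] ..
qed

lemma eigenvalue_diag_block_mat:
  assumes "\<forall>B \<in> set Bs. square_mat B" "B \<in> set Bs" "eigenvalue B e"
  shows "eigenvalue (diag_block_mat Bs) e"
  using assms
proof (induction Bs)
  case Nil
  then show ?case by simp
next
  case (Cons C Bs)
  obtain p q where d: "C \<in> carrier_mat p p" "diag_block_mat Bs \<in> carrier_mat q q"
    "diag_block_mat (C # Bs) = four_block_mat C (0\<^sub>m p q) (0\<^sub>m q p) (diag_block_mat Bs)"
    using diag_block_mat_Cons_square Cons.prems(1) by (metis list.set_intros)
  show ?case
  proof (cases "B = C")
    case True
    then show ?thesis
      using eigenvector_four_block_left[OF d(1,2)] Cons.prems d(3) unfolding eigenvalue_def by metis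
  next
    case False
    then have "eigenvalue (diag_block_mat Bs) e" using Cons by auto
    then show ?thesis
      using eigenvector_four_block_right[OF d(1,2)] d(3) unfolding eigenvalue_def by metis
  qed
qed

text \<open>Two blocks with a common eigenvalue give two independent eigenvectors, and their span
  meets the hyperplane orthogonal to \<open>c\<close>. The product is bilinear, without
  conjugation.\<close>

lemma eigenvector_diag_block_mat_orthogonal:
  assumes "\<forall>B \<in> set Bs. square_mat B" "2 \<le> length (filter (\<lambda>B. eigenvalue B e) Bs)"
    "c \<in> carrier_vec (dim_row (diag_block_mat Bs))"
  shows "\<exists>v. eigenvector (diag_block_mat Bs) v e \<and> v \<bullet> (c :: complex vec) = 0"
  using assms
proof (induction Bs arbitrary: c)
  case Nil
  then show ?case by simp
next
  case (Cons B Bs)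
  obtain p q where d: "B \<in> carrier_mat p p" "diag_block_mat Bs \<in> carrier_mat q q"
    "diag_block_mat (B # Bs) = four_block_mat B (0\<^sub>m p q) (0\<^sub>m q p) (diag_block_mat Bs)"
    using diag_block_mat_Cons_square Cons.prems(1) by (metis list.set_intros)
  let ?D = "four_block_mat B (0\<^sub>m p q) (0\<^sub>m q p) (diag_block_mat Bs)"
  define c1 c2 where "c1 = vec_first c p" and "c2 = vec_last c q"
  have c: "c = c1 @\<^sub>v c2" "c1 \<in> carrier_vec p" "c2 \<in> carrier_vec q"
    unfolding c1_def c2_def using Cons.prems(3) d by (auto simp: vec_first_last_append)
  show ?case
  proof (cases "2 \<le> length (filter (\<lambda>B. eigenvalue B e) Bs)")
    case True
    then obtain v where v: "eigenvector (diag_block_mat Bs) v e" "v \<bullet> c2 = 0"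
      using Cons.IH[of c2] Cons.prems(1) c(3) d(2) by auto
    have "v \<in> carrier_vec q" using v d by (auto simp: eigenvector_def)
    then have "(0\<^sub>v p @\<^sub>v v) \<bullet> c = 0"
      using c v by (simp add: scalar_prod_append[of _ p _ q])
    then show ?thesis
      using eigenvector_four_block_right[OF d(1,2) v(1)] d(3) by auto
  next
    case False
    then have B: "eigenvalue B e" and 1: "filter (\<lambda>B. eigenvalue B e) Bs \<noteq> []"
      using Cons.prems(2) by (auto split: if_splits)
    obtain u where u: "eigenvector B u e" using B by (auto simp: eigenvalue_def)
    obtain C where "C \<in> set Bs" "eigenvalue C e" using 1 by (auto simp: filter_empty_conv)
    then obtain w where w: "eigenvector (diag_block_mat Bs) w e"
      using eigenvalue_diag_block_mat[of Bs C e] Cons.prems(1) by (auto simp: eigenvalue_def)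
    have uc: "u \<in> carrier_vec p" "u \<noteq> 0\<^sub>v p" "B *\<^sub>v u = e \<cdot>\<^sub>v u"
      using u d by (auto simp: eigenvector_def)
    have wc: "w \<in> carrier_vec q" "w \<noteq> 0\<^sub>v q" "diag_block_mat Bs *\<^sub>v w = e \<cdot>\<^sub>v w"
      using w d by (auto simp: eigenvector_def)
    show ?thesis
    proof (cases "u \<bullet> c1 = 0")
      case True
      then have "(u @\<^sub>v 0\<^sub>v q) \<bullet> c = 0"
        using c uc by (simp add: scalar_prod_append[of _ p _ q])
      then show ?thesis
        using eigenvector_four_block_left[OF d(1,2) u] d(3) by auto
    next
      case False
      \<comment> \<open>These coefficients make the two contributions to the product with
        \<open>c\<close> cancel. The combination is nonzero because \<open>?b\<close> is nonzero in
        this case.\<close>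
      let ?a = "w \<bullet> c2" and ?b = "- (u \<bullet> c1)"
      let ?v = "(?a \<cdot>\<^sub>v u) @\<^sub>v (?b \<cdot>\<^sub>v w)"
      have orth: "?v \<bullet> c = 0"
        using c uc wc by (simp add: scalar_prod_append[of _ p _ q])
      have "?b \<cdot>\<^sub>v w \<noteq> 0\<^sub>v q"
      proof
        assume "?b \<cdot>\<^sub>v w = 0\<^sub>v q"
        then have "?b * w $ i = 0" if "i < q" for i
          using that wc(1) by (metis carrier_vecD index_smult_vec(1) index_zero_vec(1))
        then have "w = 0\<^sub>v q" using False wc(1) by (auto intro!: eq_vecI)
        then show False using wc by simp
      qed
      then have "eigenvector ?D ?v e"
        using uc wc by (intro eigenvector_four_block_diag[OF d(1,2)])
          (auto simp: mult_mat_vec[OF d(1)] mult_mat_vec[OF d(2)] smult_smult_assoc mult.commute)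
      then show ?thesis using orth d(3) by auto
    qed
  qed
qed

text \<open>Carries an entry bound for the whole block-diagonal matrix over to each block.\<close>

lemma diag_block_mat_entry:
  assumes "\<forall>B \<in> set Bs. square_mat B" "B \<in> set Bs" "i < dim_row B" "j < dim_row B"
  shows "\<exists>a < dim_row (diag_block_mat Bs). \<exists>b < dim_row (diag_block_mat Bs).
    B $$ (i, j) = diag_block_mat Bs $$ (a, b)"
  using assms
proof (induction Bs)
  case Nil
  then show ?case by simp
next
  case (Cons C Bs)
  obtain p q where d: "C \<in> carrier_mat p p" "diag_block_mat Bs \<in> carrier_mat q q"
    "diag_block_mat (C # Bs) = four_block_mat C (0\<^sub>m p q) (0\<^sub>m q p) (diag_block_mat Bs)"
    using diag_block_mat_Cons_square Cons.prems(1) by (metis list.set_intros)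
  show ?case
  proof (cases "B = C")
    case True
    then show ?thesis using Cons.prems d
      by (intro exI[of _ i] exI[of _ j] conjI) (simp_all add: d(3) del: diag_block_mat.simps)
  next
    case False
    then obtain a b where "a < q" "b < q" "B $$ (i, j) = diag_block_mat Bs $$ (a, b)"
      using Cons d by auto
    then show ?thesis using d
      by (intro exI[of _ "p + a"] exI[of _ "p + b"] conjI) (simp_all add: d(3) del: diag_block_mat.simps)
  qed
qed

lemma eigenvector_similar:
  fixes A :: "complex mat"
  assumes wit: "similar_mat_wit A D P Q" and v: "eigenvector D v e"
  shows "eigenvector A (P *\<^sub>v v) e"
proof -
  define n where "n = dim_row A"
  note w = similar_mat_witD[OF n_def wit]
  have vc: "v \<in> carrier_vec n" "v \<noteq> 0\<^sub>v n" "D *\<^sub>v v = e \<cdot>\<^sub>v v"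
    using v w by (auto simp: eigenvector_def)
  have QP: "Q *\<^sub>v (P *\<^sub>v v) = v"
    using w vc by (simp add: assoc_mult_mat_vec[symmetric, of _ n n _ n])
  have "A *\<^sub>v (P *\<^sub>v v) = P *\<^sub>v (D *\<^sub>v (Q *\<^sub>v (P *\<^sub>v v)))"
    using w(3,5,6,7) vc by (simp add: assoc_mult_mat_vec[of _ n n _ n])
  also have "\<dots> = e \<cdot>\<^sub>v (P *\<^sub>v v)"
    using w(6) vc by (simp add: QP mult_mat_vec[of _ n n])
  moreover have "P *\<^sub>v v \<noteq> 0\<^sub>v n"
  proof
    assume "P *\<^sub>v v = 0\<^sub>v n"
    moreover have "Q *\<^sub>v 0\<^sub>v n = 0\<^sub>v n" using w(7) by (intro eq_vecI) auto
    ultimately have "v = 0\<^sub>v n" using QP by simp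
    then show False using vc by simp
  qed
  ultimately show ?thesis using w vc by (auto simp: eigenvector_def)
qed

section \<open>The dimension bound\<close>

text \<open>If \<open>f\<close> counts arcs, then \<open>g\<close> counts walks of length
  \<open>l\<close>.\<close>

lemma pow_mat_of_nat:
  assumes A: "A \<in> carrier_mat n n"
    and ent: "\<And>i j. i < n \<Longrightarrow> j < n \<Longrightarrow> A $$ (i, j) = of_nat (f i j)"
    and row: "\<And>i. i < n \<Longrightarrow> (\<Sum>j<n. f i j) = k"
  shows "\<exists>g. \<forall>i<n. (\<forall>j<n. (A ^\<^sub>m l) $$ (i, j) = (of_nat (g i j) :: complex)) \<and> (\<Sum>j<n. g i j) = k ^ l"
proof (induction l)
  case 0
  show ?case
    using A by (intro exI[of _ "\<lambda>i j. if j = i then 1 else 0"]) auto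
next
  case (Suc l)
  then obtain g where g: "\<And>i j. i < n \<Longrightarrow> j < n \<Longrightarrow> (A ^\<^sub>m l) $$ (i, j) = of_nat (g i j)"
    "\<And>i. i < n \<Longrightarrow> (\<Sum>j<n. g i j) = k ^ l" by blast
  have "(A ^\<^sub>m Suc l) $$ (i, j) = of_nat (\<Sum>a<n. g i a * f a j)" if "i < n" "j < n" for i j
    using that by (simp add: index_mult_mat_sum[OF pow_carrier_mat[OF A] A] g(1) ent del: index_mult_mat(1))
  moreover have "(\<Sum>j<n. \<Sum>a<n. g i a * f a j) = k ^ Suc l" if "i < n" for i
  proof -
    have "(\<Sum>j<n. \<Sum>a<n. g i a * f a j) = (\<Sum>a<n. g i a * (\<Sum>j<n. f a j))"
      by (subst sum.swap) (simp add: sum_distrib_left)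
    also have "\<dots> = (\<Sum>a<n. g i a) * k"
      by (simp add: row sum_distrib_right)
    finally show ?thesis using g(2)[OF that] by simp
  qed
  ultimately show ?case by (intro exI[of _ "\<lambda>i j. \<Sum>a<n. g i a * f a j"]) simp
qed

text \<open>A natural number is at most its square, so the squared Frobenius norm dominates the sum
  of all entries.\<close>

lemma frobenius_sq_pow_ge:
  assumes A: "A \<in> carrier_mat n n"
    and ent: "\<And>i j. i < n \<Longrightarrow> j < n \<Longrightarrow> A $$ (i, j) = of_nat (f i j)"
    and row: "\<And>i. i < n \<Longrightarrow> (\<Sum>j<n. f i j) = k"
  shows "real n * real k ^ l \<le> frobenius_sq (A ^\<^sub>m l)"
proof -
  obtain g where g: "\<And>i j. i < n \<Longrightarrow> j < n \<Longrightarrow> (A ^\<^sub>m l) $$ (i, j) = of_nat (g i j)"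
    "\<And>i. i < n \<Longrightarrow> (\<Sum>j<n. g i j) = k ^ l"
    using pow_mat_of_nat[OF A ent row, of l] by blast
  have "real n * real k ^ l = (\<Sum>i<n. real (\<Sum>j<n. g i j))"
    by (simp only: of_nat_power[symmetric]) (simp add: g(2))
  also have "\<dots> = (\<Sum>i<n. \<Sum>j<n. real (g i j))" by simp
  also have "\<dots> \<le> (\<Sum>i<n. \<Sum>j<n. (real (g i j))\<^sup>2)"
  proof (intro sum_mono)
    fix i j
    have "g i j \<le> (g i j)\<^sup>2" by (simp add: power2_eq_square)
    then show "real (g i j) \<le> (real (g i j))\<^sup>2" by (metis of_nat_le_iff of_nat_power)
  qed
  also have "\<dots> = frobenius_sq (A ^\<^sub>m l)"
    unfolding frobenius_sq_def carrier_matD[OF pow_carrier_mat[OF A]] by (simp add: g(1))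
  finally show ?thesis .
qed

text \<open>A Schur test: the entry equals \<open>x* A y\<close> for two unit columns
  \<open>x\<close>, \<open>y\<close> of \<open>U\<close>. After
  \<open>|x y| \<le> (|x|^2 + |y|^2) / 2\<close>, the row sums control the part with
  \<open>x\<close> and the column sums the part with \<open>y\<close>.\<close>

lemma unitarily_equivalent_entry_le:
  assumes wit: "similar_mat_wit A D U (mat_adjoint U)" and A: "A \<in> carrier_mat n n"
    and ent: "\<And>i j. i < n \<Longrightarrow> j < n \<Longrightarrow> A $$ (i, j) = of_nat (f i j)"
    and row: "\<And>i. i < n \<Longrightarrow> (\<Sum>j<n. f i j) = k"
    and col: "\<And>j. j < n \<Longrightarrow> (\<Sum>i<n. f i j) = k"
    and i: "i < n" and j: "j < n"
  shows "cmod (D $$ (i, j)) \<le> real k"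
proof -
  note w = similar_mat_witD2[OF A wit]
  note w' = similar_mat_witD2[OF w(5) similar_mat_wit_sym[OF wit]]
  have unit: "(\<Sum>a<n. (cmod (U $$ (a, i)))\<^sup>2) = 1" if "i < n" for i
  proof -
    have "complex_of_real (\<Sum>a<n. (cmod (U $$ (a, i)))\<^sup>2) = 1"
      using unitary_columns[OF w(6) w(2) that that] by (simp only: of_real_sum complex_norm_square) simp
    then show ?thesis by (simp only: of_real_eq_1_iff)
  qed
  let ?x = "\<lambda>a. cmod (U $$ (a, i))" and ?y = "\<lambda>b. cmod (U $$ (b, j))"
  have "D $$ (i, j) = (mat_adjoint U * (A * U)) $$ (i, j)"
    using w'(3) w by (simp add: assoc_mult_mat[of _ n n _ n _ n])
  also have "\<dots> = (\<Sum>a<n. cnj (U $$ (a, i)) * (A * U) $$ (a, j))"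
    by (subst index_mult_mat_sum[OF w(7) mult_carrier_mat[OF A w(6)] i j])
       (simp add: mat_adjoint_index[OF w(6)] i del: index_mult_mat(1))
  also have "\<dots> = (\<Sum>a<n. cnj (U $$ (a, i)) * (\<Sum>b<n. of_nat (f a b) * U $$ (b, j)))"
    by (simp add: index_mult_mat_sum[OF A w(6) _ j] ent del: index_mult_mat(1))
  also have "\<dots> = (\<Sum>a<n. \<Sum>b<n. cnj (U $$ (a, i)) * (of_nat (f a b) * U $$ (b, j)))"
    by (simp add: sum_distrib_left)
  finally have "cmod (D $$ (i, j)) \<le> (\<Sum>a<n. \<Sum>b<n. cmod (cnj (U $$ (a, i)) * (of_nat (f a b) * U $$ (b, j))))"
    by (auto intro!: order_trans[OF norm_sum] sum_mono)
  also have "\<dots> = (\<Sum>a<n. \<Sum>b<n. real (f a b) * (?x a * ?y b))"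
    by (simp add: norm_mult mult_ac)
  also have "\<dots> \<le> (\<Sum>a<n. \<Sum>b<n. real (f a b) * (((?x a)\<^sup>2 + (?y b)\<^sup>2) / 2))"
  proof (intro sum_mono mult_left_mono)
    fix a b
    show "?x a * ?y b \<le> ((?x a)\<^sup>2 + (?y b)\<^sup>2) / 2"
      using sum_squares_bound[of "?x a" "?y b"] by simp
  qed simp
  also have "\<dots> = (\<Sum>a<n. \<Sum>b<n. real (f a b) * (?x a)\<^sup>2 / 2) + (\<Sum>a<n. \<Sum>b<n. real (f a b) * (?y b)\<^sup>2 / 2)"
    by (simp add: add_divide_distrib distrib_left sum.distrib)
  also have "(\<Sum>a<n. \<Sum>b<n. real (f a b) * (?x a)\<^sup>2 / 2) = (\<Sum>a<n. real (\<Sum>b<n. f a b) * (?x a)\<^sup>2 / 2)"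
    by (simp add: sum_distrib_right sum_divide_distrib)
  also have "\<dots> = real k / 2"
    using unit[OF i] by (simp add: row sum_distrib_left[symmetric] sum_divide_distrib[symmetric])
  also have "(\<Sum>a<n. \<Sum>b<n. real (f a b) * (?y b)\<^sup>2 / 2) = (\<Sum>b<n. real (\<Sum>a<n. f a b) * (?y b)\<^sup>2 / 2)"
    by (subst sum.swap) (simp add: sum_distrib_right sum_divide_distrib)
  also have "\<dots> = real k / 2"
    using unit[OF j] by (simp add: col sum_distrib_left[symmetric] sum_divide_distrib[symmetric])
  finally show ?thesis by simp
qed

text \<open>A union bound for lists, counted with multiplicity.\<close>

lemma length_filter_Bex_le:
  assumes "finite E"
  shows "length (filter (\<lambda>x. \<exists>e\<in>E. P x e) xs) \<le> (\<Sum>e\<in>E. length (filter (\<lambda>x. P x e) xs))"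
proof (induction xs)
  case Nil
  then show ?case by simp
next
  case (Cons x xs)
  have "(\<Sum>e\<in>E. length (filter (\<lambda>x. P x e) (x # xs)))
      = (\<Sum>e\<in>E. (if P x e then 1 else 0)) + (\<Sum>e\<in>E. length (filter (\<lambda>x. P x e) xs))"
    by (subst sum.distrib[symmetric], intro sum.cong) auto
  moreover have "1 \<le> (\<Sum>e\<in>E. (if P x e then 1 else 0 :: nat))" if "e \<in> E" "P x e" for e
    using member_le_sum[of e E "\<lambda>e. if P x e then 1 else 0 :: nat"] that assms by simp
  ultimately show ?case using Cons by fastforce
qed

text \<open>
  \<open>E\<close> stands for the set of trivial eigenvalues. That no eigenvector for \<open>e\<close> is orthogonal to the vector \<open>c\<close>
  forces the eigenspace of \<open>e\<close> to have dimension at most 1.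
\<close>

lemma dimension_bound:
  fixes k m r :: nat and \<sigma> :: real
  assumes \<sigma>: "0 \<le> \<sigma>" "\<sigma> < sqrt (real k)"
  shows "\<exists>N. \<forall>n A f Bs E.
    A \<in> carrier_mat n n \<and> (\<forall>i<n. \<forall>j<n. A $$ (i, j) = of_nat (f i j)) \<and>
    (\<forall>i<n. (\<Sum>j<n. f i j) = k) \<and> (\<forall>j<n. (\<Sum>i<n. f i j) = k) \<and>
    (\<forall>B \<in> set Bs. square_mat B \<and> dim_row B \<le> r) \<and> unitarily_equivalent A (diag_block_mat Bs) \<and>
    finite E \<and> card E \<le> m \<and> (\<forall>e. eigenvalue A e \<longrightarrow> e \<in> E \<or> cmod e \<le> \<sigma>) \<and>
    (\<forall>e \<in> E. \<exists>c \<in> carrier_vec n. \<forall>v. eigenvector A v e \<longrightarrow> v \<bullet> c \<noteq> 0)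
    \<longrightarrow> n \<le> (N :: nat)"
proof -
  have k: "1 \<le> k" using \<sigma> by (cases k) auto
  \<comment> \<open>Half the gap keeps \<open>\<sigma> + W\<close> below \<open>sqrt k\<close>; the
    cap at 1 is what \<open>l1_norm_pow_le_spectral\<close> asks for.\<close>
  define W where "W = min 1 ((sqrt (real k) - \<sigma>) / 2)"
  have W: "0 < W" "W \<le> 1" "\<sigma> + W < sqrt (real k)"
    using \<sigma> by (auto simp: W_def min_def field_simps)
  \<comment> \<open>A block has at most \<open>r * r\<close> entries, each of modulus at most
    \<open>k\<close>, so \<open>b\<close> bounds its \<open>l1_norm\<close>.\<close>
  define b where "b = real r * (real r * real k)"
  define c where "c = b + \<sigma> * real r + 1"
  define K where "K = (real r * (c / W) ^ r)\<^sup>2"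
  \<comment> \<open>The ratio of the squared growth rate of the good blocks to \<open>k\<close>. It
    is below 1, so some exponent \<open>l\<close>, chosen before \<open>n\<close>, beats the
    constant \<open>K\<close>.\<close>
  define x where "x = (\<sigma> + W)\<^sup>2 / real k"
  have "(\<sigma> + W)\<^sup>2 < (sqrt (real k))\<^sup>2"
    using W \<sigma> by (intro power_strict_mono) auto
  then have "x < 1" using k by (simp add: x_def)
  have K: "0 \<le> K" by (simp add: K_def)
  then have "0 < 1 / (2 * (K + 1))" by simp
  then obtain l where l: "x ^ l < 1 / (2 * (K + 1))"
    using real_arch_pow_inv \<open>x < 1\<close> by blast
  have x: "0 \<le> x" by (simp add: x_def)
  have "K * x ^ l \<le> (K + 1) * (1 / (2 * (K + 1)))"
    using K x l by (intro mult_mono) auto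
  also have "\<dots> = 1 / 2" using K by (simp add: field_simps)
  finally have Kl: "K * x ^ l \<le> 1 / 2" .
  \<comment> \<open>\<open>S\<close> bounds the squared Frobenius norm of the \<open>l\<close>-th
    power of a block without trivial eigenvalue; \<open>R\<close> below does so for the other
    blocks.\<close>
  define S where "S = (real r * (c / W) ^ r * (\<sigma> + W) ^ l)\<^sup>2"
  have "((\<sigma> + W) ^ l)\<^sup>2 = ((\<sigma> + W)\<^sup>2) ^ l"
    by (metis power_mult mult.commute)
  then have "S = K * x ^ l * real k ^ l"
    using k by (simp add: S_def K_def x_def power_mult_distrib[of _ "(\<sigma> + W) ^ l"] power_divide)
  then have S: "S \<le> real k ^ l / 2"
    using mult_right_mono[OF Kl, of "real k ^ l"] by simp
  define R where "R = (real r * b ^ l)\<^sup>2"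
  show ?thesis
  proof (intro exI allI impI, elim conjE)
    fix n A f Bs and E :: "complex set"
    assume A: "A \<in> carrier_mat n n" and ent: "\<forall>i<n. \<forall>j<n. A $$ (i, j) = of_nat (f i j)"
      and row: "\<forall>i<n. (\<Sum>j<n. f i j) = k" and col: "\<forall>j<n. (\<Sum>i<n. f i j) = k"
      and Bs: "\<forall>B \<in> set Bs. square_mat B \<and> dim_row B \<le> r"
      and ue: "unitarily_equivalent A (diag_block_mat Bs)"
      and E: "finite E" "card E \<le> m" and eig: "\<forall>e. eigenvalue A e \<longrightarrow> e \<in> E \<or> cmod e \<le> \<sigma>"
      and simple: "\<forall>e \<in> E. \<exists>c \<in> carrier_vec n. \<forall>v. eigenvector A v e \<longrightarrow> v \<bullet> c \<noteq> 0"
    let ?D = "diag_block_mat Bs"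
    obtain U where wit: "similar_mat_wit A ?D U (mat_adjoint U)"
      using ue by (auto simp: unitarily_equivalent_def)
    note w = similar_mat_witD2[OF A wit]
    have sq: "\<forall>B \<in> set Bs. square_mat B" using Bs by blast
    have dimD: "(\<Sum>B\<leftarrow>Bs. dim_row B) = n"
      using w(5) dim_diag_block_mat(1)[of Bs] by simp
    define bad where "bad B \<longleftrightarrow> (\<exists>e\<in>E. eigenvalue B e)" for B
    \<comment> \<open>Two such blocks would give an eigenvector \<open>v\<close> orthogonal to the
      pulled-back vector \<open>transpose_mat U *\<^sub>v c\<close>; then
      \<open>U *\<^sub>v v\<close> is an eigenvector of \<open>A\<close> orthogonal to
      \<open>c\<close>.\<close>
    have "length (filter (\<lambda>B. eigenvalue B e) Bs) \<le> 1" if e: "e \<in> E" for e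
    proof (rule ccontr)
      assume "\<not> ?thesis"
      then have 2: "2 \<le> length (filter (\<lambda>B. eigenvalue B e) Bs)" by simp
      obtain c where c: "c \<in> carrier_vec n" "\<And>v. eigenvector A v e \<Longrightarrow> v \<bullet> c \<noteq> 0"
        using simple e by blast
      have Uc: "transpose_mat U *\<^sub>v c \<in> carrier_vec n"
        using w(6) c(1) by (intro mult_mat_vec_carrier) auto
      obtain v where v: "eigenvector ?D v e" "v \<bullet> (transpose_mat U *\<^sub>v c) = 0"
        using eigenvector_diag_block_mat_orthogonal[OF sq 2, of "transpose_mat U *\<^sub>v c"] Uc w(5) by auto
      have vc: "v \<in> carrier_vec n" using v(1) w(5) by (auto simp: eigenvector_def)
      have "(U *\<^sub>v v) \<bullet> c = c \<bullet> (U *\<^sub>v v)"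
        using w(6) vc c(1) by (intro comm_scalar_prod[of _ n]) auto
      also have "\<dots> = (transpose_mat U *\<^sub>v c) \<bullet> v"
        using transpose_vec_mult_scalar[OF w(6) vc c(1)] by simp
      also have "\<dots> = 0" using v(2) comm_scalar_prod[OF vc Uc] by simp
      finally show False using c(2)[OF eigenvector_similar[OF wit v(1)]] by simp
    qed
    then have "(\<Sum>e\<in>E. length (filter (\<lambda>B. eigenvalue B e) Bs)) \<le> card E"
      using sum_mono[of E "\<lambda>e. length (filter (\<lambda>B. eigenvalue B e) Bs)" "\<lambda>_. 1"] by simp
    then have nbad: "length (filter bad Bs) \<le> m"
      using length_filter_Bex_le[OF E(1), of eigenvalue Bs] E(2) unfolding bad_def by linarith
    \<comment> \<open>Weighting \<open>S\<close> by the block size lets the sum over all blocks be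
      expressed through \<open>n\<close>. An empty block fits, since its Frobenius norm is
      zero.\<close>
    have blk: "frobenius_sq (B ^\<^sub>m l) \<le> (if bad B then R else 0) + real (dim_row B) * S" if B: "B \<in> set Bs" for B
    proof -
      define s where "s = dim_row B"
      have Bc: "B \<in> carrier_mat s s" and s: "s \<le> r" using Bs B by (auto simp: s_def)
      have "cmod (B $$ (i, j)) \<le> real k" if "i < s" "j < s" for i j
        using diag_block_mat_entry[OF sq B, of i j] that w(5)
          unitarily_equivalent_entry_le[OF wit A, of f k] ent row col
        by (auto simp: s_def)
      then have "l1_norm B \<le> real s * (real s * real k)"
        by (rule l1_norm_le_entries[OF Bc])
      also have "\<dots> \<le> b" unfolding b_def using s by (intro mult_mono) auto
      finally have b: "l1_norm B \<le> b" .
      have S0: "0 \<le> S" by (simp add: S_def)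
      show ?thesis
      proof (cases "bad B")
        case True
        have "l1_norm (B ^\<^sub>m l) \<le> real s * l1_norm B ^ l" by (rule l1_norm_pow[OF Bc])
        also have "\<dots> \<le> real r * b ^ l"
          using s b l1_norm_nonneg by (intro mult_mono power_mono) auto
        finally have "(l1_norm (B ^\<^sub>m l))\<^sup>2 \<le> R"
          unfolding R_def by (intro power_mono l1_norm_nonneg)
        then have "frobenius_sq (B ^\<^sub>m l) \<le> R" using frobenius_sq_le_l1_norm order_trans by blast
        moreover have "0 \<le> real (dim_row B) * S" using S0 by simp
        ultimately show ?thesis using True by simp
      next
        case False
        have "cmod e \<le> \<sigma>" if e: "eigenvalue B e" for e
        proof -
          have "eigenvalue A e"
            using eigenvalue_diag_block_mat[OF sq B e] eigenvector_similar[OF wit]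
            by (auto simp: eigenvalue_def)
          then show ?thesis using eig False e by (auto simp: bad_def)
        qed
        then have "l1_norm (B ^\<^sub>m l) \<le> real r * (c / W) ^ r * (\<sigma> + W) ^ l"
          using b \<sigma> W s by (intro l1_norm_pow_le_spectral[OF Bc s]) (auto simp: c_def b_def)
        then have "(l1_norm (B ^\<^sub>m l))\<^sup>2 \<le> S"
          unfolding S_def by (intro power_mono l1_norm_nonneg)
        then have fS: "frobenius_sq (B ^\<^sub>m l) \<le> S" using frobenius_sq_le_l1_norm order_trans by blast
        have "frobenius_sq (B ^\<^sub>m l) \<le> real s * S"
        proof (cases s)
          case 0
          then show ?thesis using Bc by (simp add: frobenius_sq_def)
        next
          case (Suc s')
          then show ?thesis using fS S0 mult_right_mono[of 1 "real s" S] by simp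
        qed
        then show ?thesis using False by (simp add: s_def)
      qed
    qed
    have "real n * real k ^ l \<le> frobenius_sq (A ^\<^sub>m l)"
      using frobenius_sq_pow_ge[OF A, of f k] ent row by simp
    also have "\<dots> = frobenius_sq (?D ^\<^sub>m l)"
      by (rule frobenius_sq_unitarily_equivalent[OF similar_mat_wit_pow[OF wit]])
    also have "\<dots> = (\<Sum>B\<leftarrow>Bs. frobenius_sq (B ^\<^sub>m l))"
      by (simp add: diag_block_pow_mat[OF sq] frobenius_sq_diag_block_mat o_def)
    also have "\<dots> \<le> (\<Sum>B\<leftarrow>Bs. (if bad B then R else 0) + real (dim_row B) * S)"
      by (intro sum_list_mono blk)
    also have "\<dots> = real (length (filter bad Bs)) * R + real (\<Sum>B\<leftarrow>Bs. dim_row B) * S"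
      by (induction Bs) (auto simp: algebra_simps)
    also have "\<dots> \<le> real m * R + real n * (real k ^ l / 2)"
      unfolding dimD using nbad S by (intro add_mono mult_mono mult_left_mono) (auto simp: R_def)
    \<comment> \<open>The good blocks account for at most half of the left side, which is
      absorbed.\<close>
    finally have "real n * real k ^ l \<le> 2 * (real m * R)" by simp
    moreover have "real n * 1 \<le> real n * real k ^ l"
      using k by (intro mult_left_mono) auto
    ultimately have "real n \<le> 2 * (real m * R)" by simp
    then show "n \<le> nat \<lceil>2 * (real m * R)\<rceil>" by linarith
  qed
qed

section \<open>Regular periodic digraphs\<close>

lemma vertex_list:
  assumes "finite (verts G)"
  shows "distinct (vertex_list G)" "set (vertex_list G) = verts G"
    "length (vertex_list G) = card (verts G)"
proof -
  have "\<exists>vs. distinct vs \<and> set vs = verts G"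
    using finite_distinct_list[OF assms] by blast
  from someI_ex[OF this] show "distinct (vertex_list G)" "set (vertex_list G) = verts G"
    by (auto simp: vertex_list_def)
  then show "length (vertex_list G) = card (verts G)" by (metis distinct_card)
qed

lemma sum_card_fibres_list:
  assumes "finite S" "distinct vs" "h ` S \<subseteq> set vs"
  shows "(\<Sum>j<length vs. card {e \<in> S. h e = vs ! j}) = card S"
proof -
  have "(\<Sum>j<length vs. card {e \<in> S. h e = vs ! j}) = (\<Sum>v\<in>set vs. card {e \<in> S. h e = v})"
    by (intro sum.reindex_bij_betw[OF bij_betw_nth]) (use assms in auto)
  also have "\<dots> = (\<Sum>v\<in>set vs. \<Sum>e\<in>{e \<in> S. h e = v}. 1)" by simp
  also have "\<dots> = (\<Sum>e\<in>S. 1)"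
    using assms by (intro sum.group) auto
  finally show ?thesis by simp
qed

definition arc_count :: "('a, 'b) pre_digraph \<Rightarrow> nat \<Rightarrow> nat \<Rightarrow> nat" where
  "arc_count G i j = card {e \<in> arcs G. tail G e = vertex_list G ! i \<and> head G e = vertex_list G ! j}"

lemma adjacency_matrix_carrier:
  "adjacency_matrix G \<in> carrier_mat (card (verts G)) (card (verts G))"
  by (simp add: adjacency_matrix_def)

lemma adjacency_matrix_index:
  assumes "i < card (verts G)" "j < card (verts G)"
  shows "adjacency_matrix G $$ (i, j) = of_nat (arc_count G i j)"
  using assms by (simp add: adjacency_matrix_def arc_count_def)

lemma (in fin_digraph) sum_arc_count:
  assumes reg: "regular_digraph k G" and i: "i < card (verts G)"
  shows "(\<Sum>j<card (verts G). arc_count G i j) = k" "(\<Sum>j<card (verts G). arc_count G j i) = k"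
proof -
  let ?vs = "vertex_list G"
  note vs = vertex_list[OF finite_verts]
  have v: "?vs ! i \<in> verts G" using vs i nth_mem by metis
  have "(\<Sum>j<card (verts G). arc_count G i j) = (\<Sum>j<length ?vs. card {e \<in> out_arcs G (?vs ! i). head G e = ?vs ! j})"
    unfolding arc_count_def vs(3) by (intro sum.cong refl arg_cong[where f = card]) (auto simp: out_arcs_def)
  also have "\<dots> = card (out_arcs G (?vs ! i))"
    by (rule sum_card_fibres_list[OF _ vs(1)]) (auto simp: vs(2))
  finally show "(\<Sum>j<card (verts G). arc_count G i j) = k"
    using reg v by (simp add: regular_digraph_def out_degree_def)
  have "(\<Sum>j<card (verts G). arc_count G j i) = (\<Sum>j<length ?vs. card {e \<in> in_arcs G (?vs ! i). tail G e = ?vs ! j})"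
    unfolding arc_count_def vs(3) by (intro sum.cong refl arg_cong[where f = card]) (auto simp: in_arcs_def)
  also have "\<dots> = card (in_arcs G (?vs ! i))"
    by (rule sum_card_fibres_list[OF _ vs(1)]) (auto simp: vs(2))
  finally show "(\<Sum>j<card (verts G). arc_count G j i) = k"
    using reg v by (simp add: regular_digraph_def in_degree_def)
qed

text \<open>Connectedness is that of the symmetric closure, so a path may use arcs in either
  direction; invariance along arcs works both ways.\<close>

lemma connected_arc_invariant_constant:
  assumes "Digraph_Component.connected G"
    and inv: "\<And>e. e \<in> arcs G \<Longrightarrow> h (head G e) = h (tail G e)"
    and "u \<in> verts G" "v \<in> verts G"
  shows "h u = h v"
proof -
  have "(u, v) \<in> rtrancl_on (verts G) ((arcs_ends G)\<^sup>s)"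
    using assms by (auto simp: connected_conv)
  then show ?thesis
    by induction (auto simp: symcl_def arcs_ends_conv inv)
qed

lemma period_eq:
  assumes "periodic m G"
  shows "period G = m"
  unfolding period_def
  by (rule the_equality[of "\<lambda>m. periodic m G", OF assms]) (use assms in \<open>auto simp: periodic_def intro: antisym\<close>)

section \<open>Trivial eigenfunctions and their behaviour along arcs\<close>

definition trivial_value :: "nat \<Rightarrow> (nat \<Rightarrow> 'a set) \<Rightarrow> nat \<Rightarrow> 'a \<Rightarrow> complex" where
  "trivial_value m V t v = (\<Sum>j<m. cis (2 * pi * real j * real t / real m) * indicator (V j) v)"

lemma trivial_value_eq:
  assumes "cyclic_partition G m V" "j < m" "v \<in> V j"
  shows "trivial_value m V t v = cis (2 * pi * real j * real t / real m)"
proof -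
  have "indicator (V i) v = (if i = j then 1 else 0 :: complex)" if "i < m" for i
    using assms that unfolding cyclic_partition_def disjoint_family_on_def by (auto simp: indicator_def)
  then have "trivial_value m V t v = (\<Sum>i<m. if i = j then cis (2 * pi * real i * real t / real m) else 0)"
    unfolding trivial_value_def by (intro sum.cong refl) auto
  then show ?thesis using assms(2) by simp
qed

lemma norm_trivial_value:
  assumes "cyclic_partition G m V" "v \<in> verts G"
  shows "cmod (trivial_value m V t v) = 1"
proof -
  obtain j where "j < m" "v \<in> V j" using assms unfolding cyclic_partition_def by blast
  then show ?thesis using trivial_value_eq[OF assms(1)] by simp
qed

lemma (in wf_digraph) trivial_value_arc:
  assumes V: "cyclic_partition G m V" and e: "e \<in> arcs G"
  shows "trivial_value m V t (head G e) = cis (2 * pi * real t / real m) * trivial_value m V t (tail G e)"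
proof -
  obtain j where j: "j < m" "tail G e \<in> V j"
    using V tail_in_verts[OF e] unfolding cyclic_partition_def by blast
  have h: "head G e \<in> V ((j + 1) mod m)" using V e j by (auto simp: cyclic_partition_def)
  have "cis (2 * pi * real ((j + 1) mod m) * real t / real m) = cis (2 * pi * real (j + 1) * real t / real m)"
  \<comment> \<open>At the wrap-around from class \<open>m - 1\<close> to class 0 the phase differs
    by a multiple of \<open>2 * pi\<close>.\<close>
  proof (cases "j + 1 < m")
    case False
    then have "j + 1 = m" using j by simp
    then have "cis (2 * pi * real ((j + 1) mod m) * real t / real m) = 1" by simp
    moreover have "2 * pi * real (j + 1) * real t / real m = 2 * pi * real t"
      unfolding \<open>j + 1 = m\<close> using j by simp
    moreover have "cis (2 * pi * real t) = 1" by (rule cis_multiple_2pi) simp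
    ultimately show ?thesis by (simp only:)
  qed simp
  also have "\<dots> = cis (2 * pi * real t / real m) * cis (2 * pi * real j * real t / real m)"
    by (simp add: cis_mult field_simps add_divide_distrib)
  finally show ?thesis
    using trivial_value_eq[OF V j] trivial_value_eq[OF V _ h] j by simp
qed

text \<open>Both functions are multiplied by the same phase along every arc, so their quotient is
  constant on a connected digraph. Hence orthogonality for one partition passes to all partitions
  quantified over in \<open>L2_0\<close>.\<close>

lemma (in wf_digraph) trivial_value_unique:
  assumes conn: "Digraph_Component.connected G"
    and V: "cyclic_partition G m V" and V': "cyclic_partition G m V'"
    and eq: "cis (2 * pi * real t / real m) = cis (2 * pi * real t' / real m)"
  obtains z where "\<And>v. v \<in> verts G \<Longrightarrow> trivial_value m V' t' v = z * trivial_value m V t v"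
proof -
  define h where "h v = trivial_value m V' t' v / trivial_value m V t v" for v
  have nz: "trivial_value m V t v \<noteq> 0" if "v \<in> verts G" for v
    using norm_trivial_value[OF V that, of t] by auto
  have inv: "h (head G e) = h (tail G e)" if "e \<in> arcs G" for e
    unfolding h_def trivial_value_arc[OF V that] trivial_value_arc[OF V' that] eq by simp
  have const: "h u = h v" if "u \<in> verts G" "v \<in> verts G" for u v
    by (rule connected_arc_invariant_constant[of G h, OF conn]) (use inv that in auto)
  obtain v0 where v0: "v0 \<in> verts G" using conn by (auto simp: connected_conv)
  have "trivial_value m V' t' v = h v0 * trivial_value m V t v" if "v \<in> verts G" for v
    unfolding const[OF v0 that] using nz[OF that] by (simp add: h_def)
  then show ?thesis using that by blast
qed

lemma trivial_eigenfunction_eq: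
  "trivial_eigenfunction G V t
    = vec (card (verts G)) (\<lambda>i. trivial_value (period G) V t (vertex_list G ! i))"
  by (simp add: trivial_eigenfunction_def trivial_value_def)

text \<open>The conjugated trivial eigenfunction is a left eigenvector, since the column sums are
  \<open>k\<close>. Evaluating the pairing with \<open>A v\<close> in two ways gives two multiples
  of the same inner product, with different factors.\<close>

lemma eigenvector_adjacency_orthogonal:
  assumes fin: "fin_digraph G" and reg: "regular_digraph k G"
    and V: "cyclic_partition G (period G) V"
    and v: "eigenvector (adjacency_matrix G) v e"
    and ne: "e \<noteq> of_nat k * cis (2 * pi * real t / real (period G))"
  shows "v \<bullet>c trivial_eigenfunction G V t = 0"
proof -
  interpret fin_digraph G by fact
  define n where "n = card (verts G)"
  let ?A = "adjacency_matrix G" and ?w = "cis (2 * pi * real t / real (period G))"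
  define \<gamma> where "\<gamma> i = trivial_value (period G) V t (vertex_list G ! i)" for i
  have A: "?A \<in> carrier_mat n n" unfolding n_def by (rule adjacency_matrix_carrier)
  have vc: "v \<in> carrier_vec n" "?A *\<^sub>v v = e \<cdot>\<^sub>v v" using v A by (auto simp: eigenvector_def)
  have inner: "v \<bullet>c trivial_eigenfunction G V t = (\<Sum>i<n. v $ i * cnj (\<gamma> i))"
    unfolding trivial_eigenfunction_eq scalar_prod_def n_def \<gamma>_def by (simp add: atLeast0LessThan)
  have Av: "(\<Sum>j<n. of_nat (arc_count G i j) * v $ j) = e * v $ i" if "i < n" for i
  proof -
    have "(?A *\<^sub>v v) $ i = (\<Sum>j<n. ?A $$ (i, j) * v $ j)"
      using that A vc(1) by (auto simp: scalar_prod_def atLeast0LessThan)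
    then show ?thesis
      using that vc adjacency_matrix_index[of i G] by (simp add: n_def)
  qed
  \<comment> \<open>Only pairs joined by an arc matter; there
    \<open>\<gamma> j = ?w * \<gamma> i\<close>, and \<open>?w\<close> has modulus 1.\<close>
  have step: "of_nat (arc_count G i j) * cnj (\<gamma> i) = of_nat (arc_count G i j) * (?w * cnj (\<gamma> j))" for i j
  proof (cases "arc_count G i j = 0")
    case False
    then obtain a where a: "a \<in> arcs G" "tail G a = vertex_list G ! i" "head G a = vertex_list G ! j"
      unfolding arc_count_def by (metis (mono_tags, lifting) card.empty empty_Collect_eq)
    have "\<gamma> j = ?w * \<gamma> i" using trivial_value_arc[OF V a(1), of t] a by (simp add: \<gamma>_def)
    then have "?w * cnj (\<gamma> j) = (?w * cnj ?w) * cnj (\<gamma> i)" by simp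
    also have "?w * cnj ?w = 1" by (simp add: cis_cnj cis_mult)
    finally show ?thesis by simp
  qed simp
  have "e * (v \<bullet>c trivial_eigenfunction G V t) = (\<Sum>i<n. (\<Sum>j<n. of_nat (arc_count G i j) * v $ j) * cnj (\<gamma> i))"
    unfolding inner sum_distrib_left by (intro sum.cong refl) (simp add: Av)
  also have "\<dots> = (\<Sum>j<n. \<Sum>i<n. v $ j * (of_nat (arc_count G i j) * cnj (\<gamma> i)))"
    by (subst sum.swap) (simp add: sum_distrib_left sum_distrib_right mult_ac)
  also have "\<dots> = (\<Sum>j<n. \<Sum>i<n. v $ j * (of_nat (arc_count G i j) * (?w * cnj (\<gamma> j))))"
    by (simp only: step)
  also have "\<dots> = (\<Sum>j<n. of_nat (\<Sum>i<n. arc_count G i j) * (?w * (v $ j * cnj (\<gamma> j))))"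
    by (simp add: sum_distrib_left sum_distrib_right mult_ac)
  also have "\<dots> = of_nat k * ?w * (v \<bullet>c trivial_eigenfunction G V t)"
    using sum_arc_count(2)[OF reg] unfolding inner by (simp add: n_def sum_distrib_left mult_ac)
  finally show ?thesis using ne by simp
qed

text \<open>Eigenvalues are roots of the nonzero characteristic polynomial. Finiteness is what makes
  the \<open>Max\<close> in \<open>rho\<close> an upper bound.\<close>

lemma finite_eigenvector_norms:
  assumes A: "A \<in> carrier_mat n n"
  shows "finite {cmod c | c. \<exists>f \<in> S. eigenvector A f c}"
proof (rule finite_subset)
  have "char_poly A \<noteq> 0" using degree_monic_char_poly[OF A] by auto
  then show "finite (cmod ` {c. poly (char_poly A) c = 0})"
    using poly_roots_finite by blast
  show "{cmod c | c. \<exists>f \<in> S. eigenvector A f c} \<subseteq> cmod ` {c. poly (char_poly A) c = 0}"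
    using eigenvalue_root_char_poly[OF A] by (auto simp: eigenvalue_def)
qed

lemma rho_ge:
  assumes "f \<in> L2_0 G" "eigenvector (adjacency_matrix G) f c"
  shows "cmod c \<le> rho G"
  unfolding rho_def
  by (rule Max_ge) (use assms finite_eigenvector_norms[OF adjacency_matrix_carrier] in auto)

lemma rho_nonneg: "0 \<le> rho G"
  unfolding rho_def
  by (rule Max_ge) (use finite_eigenvector_norms[OF adjacency_matrix_carrier] in auto)

lemma card_verts_bounded:
  fixes k m r :: nat and \<epsilon> :: real
  assumes k: "k \<ge> 1" and \<epsilon>: "\<epsilon> > 0"
  shows "\<exists>N. \<forall>G :: ('a, 'b) pre_digraph.
    fin_digraph G \<and> Digraph_Component.connected G \<and> regular_digraph k G \<and> periodic m G \<and>
    r_normal r G \<and> rho G \<le> sqrt (real k) - \<epsilon> \<longrightarrow> card (verts G) \<le> N"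
proof (cases "0 \<le> sqrt (real k) - \<epsilon>")
  case False
  \<comment> \<open>A negative bound on \<open>rho\<close> admits no digraph at all.\<close>
  then show ?thesis using rho_nonneg by (meson order_trans)
next
  case True
  define \<sigma> where "\<sigma> = sqrt (real k) - \<epsilon>"
  have \<sigma>: "0 \<le> \<sigma>" "\<sigma> < sqrt (real k)" using True \<epsilon> by (auto simp: \<sigma>_def)
  obtain N where N: "\<And>n A f Bs E.
    A \<in> carrier_mat n n \<and> (\<forall>i<n. \<forall>j<n. A $$ (i, j) = of_nat (f i j)) \<and>
    (\<forall>i<n. (\<Sum>j<n. f i j) = k) \<and> (\<forall>j<n. (\<Sum>i<n. f i j) = k) \<and>
    (\<forall>B \<in> set Bs. square_mat B \<and> dim_row B \<le> r) \<and> unitarily_equivalent A (diag_block_mat Bs) \<and>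
    finite E \<and> card E \<le> m \<and> (\<forall>e. eigenvalue A e \<longrightarrow> e \<in> E \<or> cmod e \<le> \<sigma>) \<and>
    (\<forall>e \<in> E. \<exists>c \<in> carrier_vec n. \<forall>v. eigenvector A v e \<longrightarrow> v \<bullet> c \<noteq> 0)
    \<Longrightarrow> n \<le> (N :: nat)"
    using dimension_bound[OF \<sigma>, of r m] by blast
  show ?thesis
  proof (intro exI allI impI, elim conjE)
    fix G :: "('a, 'b) pre_digraph"
    assume fin: "fin_digraph G" and conn: "Digraph_Component.connected G" and reg: "regular_digraph k G"
      and per: "periodic m G" and rn: "r_normal r G" and rho: "rho G \<le> sqrt (real k) - \<epsilon>"
    interpret fin_digraph G by fact
    note pm = period_eq[OF per]
    let ?A = "adjacency_matrix G" and ?n = "card (verts G)"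
    define ev where "ev t = of_nat k * cis (2 * pi * real t / real m)" for t
    note orth = eigenvector_adjacency_orthogonal[OF fin reg, unfolded pm, folded ev_def]
    obtain Bs where Bs: "\<forall>B \<in> set Bs. square_mat B \<and> dim_row B \<le> r"
      "unitarily_equivalent ?A (diag_block_mat Bs)"
      using rn by (auto simp: r_normal_def r_normal_mat_def)
    obtain V where V: "cyclic_partition G m V" using per by (auto simp: periodic_def)
    have carr: "v \<in> carrier_vec ?n" if "eigenvector ?A v e" for v e
      using that adjacency_matrix_carrier[of G] by (auto simp: eigenvector_def)
    show "?n \<le> N"
    proof (rule N[of ?A ?n "arc_count G" Bs "ev ` {..<m}"], intro conjI)
      show "\<forall>i<?n. \<forall>j<?n. ?A $$ (i, j) = of_nat (arc_count G i j)"
        using adjacency_matrix_index by blast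
      show "card (ev ` {..<m}) \<le> m" using card_image_le[of "{..<m}" ev] by simp
      \<comment> \<open>An eigenvector for a larger eigenvalue lies outside \<open>L2_0\<close>, so
        it fails to be orthogonal to some trivial eigenfunction; its eigenvalue must then be the
        matching \<open>ev t\<close>.\<close>
      show "\<forall>e. eigenvalue ?A e \<longrightarrow> e \<in> ev ` {..<m} \<or> cmod e \<le> \<sigma>"
      proof (intro allI impI disjCI)
        fix e assume "eigenvalue ?A e" and e: "\<not> cmod e \<le> \<sigma>"
        then obtain v where v: "eigenvector ?A v e" by (auto simp: eigenvalue_def)
        then have "v \<notin> L2_0 G" using rho_ge[of v G e] rho e by (auto simp: \<sigma>_def)
        then obtain V' t where "cyclic_partition G m V'" "t < m" "v \<bullet>c trivial_eigenfunction G V' t \<noteq> 0"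
          using carr[OF v] by (auto simp: L2_0_def pm)
        then show "e \<in> ev ` {..<m}" using orth[of V' v e t] v by auto
      qed
      show "\<forall>e \<in> ev ` {..<m}. \<exists>c \<in> carrier_vec ?n. \<forall>v. eigenvector ?A v e \<longrightarrow> v \<bullet> c \<noteq> 0"
      proof (intro ballI)
        fix e assume "e \<in> ev ` {..<m}"
        then obtain t where t: "t < m" "e = ev t" by auto
        \<comment> \<open>Otherwise \<open>v\<close> would be orthogonal to every trivial
          eigenfunction: to those of other eigenvalues by \<open>orth\<close>, to those of the same
          eigenvalue by proportionality. Then \<open>v\<close> is in \<open>L2_0\<close> and
          \<open>k = cmod e \<le> rho G < sqrt k\<close>, which is impossible.\<close>
        have "v \<bullet>c trivial_eigenfunction G V t \<noteq> 0" if v: "eigenvector ?A v e" for v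
        proof
          assume 0: "v \<bullet>c trivial_eigenfunction G V t = 0"
          have "v \<bullet>c trivial_eigenfunction G V' t' = 0" if V': "cyclic_partition G m V'" and "t' < m" for V' t'
          proof (cases "e = ev t'")
            case False
            then show ?thesis using orth[OF V' v] by blast
          next
            case True
            then have "cis (2 * pi * real t / real m) = cis (2 * pi * real t' / real m)"
              using t k by (simp add: ev_def)
            then obtain z where z: "\<And>v. v \<in> verts G \<Longrightarrow> trivial_value m V' t' v = z * trivial_value m V t v"
              using trivial_value_unique[OF conn V V'] by blast
            have "vertex_list G ! i \<in> verts G" if "i < ?n" for i
              using vertex_list[OF finite_verts] that nth_mem by metis
            then have "v \<bullet>c trivial_eigenfunction G V' t' = cnj z * (v \<bullet>c trivial_eigenfunction G V t)"
              using carr[OF v] z unfolding trivial_eigenfunction_eq pm scalar_prod_def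
              by (simp add: sum_distrib_left mult_ac)
            then show ?thesis using 0 by simp
          qed
          then have "v \<in> L2_0 G" using carr[OF v] by (auto simp: L2_0_def pm)
          then have "cmod e \<le> rho G" using rho_ge v by blast
          moreover have "cmod e = real k" by (simp add: t ev_def norm_mult)
          moreover have "sqrt (real k) \<le> real k"
            using k by (intro real_le_lsqrt) (auto simp: power2_eq_square)
          ultimately show False using rho \<epsilon> by simp
        qed
        then show "\<exists>c \<in> carrier_vec ?n. \<forall>v. eigenvector ?A v e \<longrightarrow> v \<bullet> c \<noteq> 0"
          by (intro bexI[of _ "conjugate (trivial_eigenfunction G V t)"])
             (auto simp: trivial_eigenfunction_def)
      qed
    qed (use adjacency_matrix_carrier Bs sum_arc_count[OF reg] in auto)
  qed
qed

section \<open>Isomorphism classes\<close>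

text \<open>A finite code of a digraph: the list \<open>ps\<close> holds the numbered ends of each
  arc, with repetitions for parallel arcs.\<close>

definition presented_by :: "nat \<Rightarrow> (nat \<times> nat) list \<Rightarrow> ('a, 'b) pre_digraph \<Rightarrow> bool" where
  "presented_by n ps G \<longleftrightarrow> wf_digraph G \<and>
     (\<exists>f g. bij_betw f {..<n} (verts G) \<and> bij_betw g {..<length ps} (arcs G) \<and>
        (\<forall>i<length ps. tail G (g i) = f (fst (ps ! i)) \<and> head G (g i) = f (snd (ps ! i))))"

lemma fin_digraph_presented:
  assumes "fin_digraph G"
  obtains ps where "set ps \<subseteq> {..<card (verts G)} \<times> {..<card (verts G)}" "length ps = card (arcs G)"
    "presented_by (card (verts G)) ps G"
proof -
  interpret fin_digraph G by fact
  obtain f where f: "bij_betw f {..<card (verts G)} (verts G)"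
    using ex_bij_betw_nat_finite[OF finite_verts] by (auto simp: atLeast0LessThan)
  obtain g where g: "bij_betw g {..<card (arcs G)} (arcs G)"
    using ex_bij_betw_nat_finite[OF finite_arcs] by (auto simp: atLeast0LessThan)
  define f' where "f' = inv_into {..<card (verts G)} f"
  have f': "f (f' v) = v" "f' v < card (verts G)" if "v \<in> verts G" for v
    using bij_betw_inv_into_right[OF f that] bij_betwE[OF bij_betw_inv_into[OF f]] that
    by (auto simp: f'_def)
  have g_arc: "g i \<in> arcs G" if "i < card (arcs G)" for i
    using bij_betwE[OF g] that by simp
  define ps where "ps = map (\<lambda>i. (f' (tail G (g i)), f' (head G (g i)))) [0..<card (arcs G)]"
  show ?thesis
  proof
    show "length ps = card (arcs G)" by (simp add: ps_def)
    show "set ps \<subseteq> {..<card (verts G)} \<times> {..<card (verts G)}"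
      using g_arc f' by (auto simp: ps_def)
    show "presented_by (card (verts G)) ps G"
      unfolding presented_by_def using f g g_arc f' wf_digraph_axioms
      by (intro conjI exI[of _ f] exI[of _ g]) (auto simp: ps_def)
  qed
qed

text \<open>Isomorphisms transport enumerations, and two digraphs with the same code are matched
  index by index. The class thus depends only on the code.\<close>

lemma iso_class_presented:
  assumes G: "presented_by n ps G" and ps: "set ps \<subseteq> {..<n} \<times> {..<n}"
  shows "iso_rel `` {G} = {K. presented_by n ps K}"
proof (intro equalityI subsetI CollectI)
  interpret wf_digraph G using G by (simp add: presented_by_def)
  obtain f g where f: "bij_betw f {..<n} (verts G)" and g: "bij_betw g {..<length ps} (arcs G)"
    and ends: "\<And>i. i < length ps \<Longrightarrow> tail G (g i) = f (fst (ps ! i)) \<and> head G (g i) = f (snd (ps ! i))"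
    using G by (auto simp: presented_by_def)
  have g_arc: "g i \<in> arcs G" if "i < length ps" for i
    using bij_betwE[OF g] that by simp
  {
    fix K :: "('a, 'b) pre_digraph" assume "K \<in> iso_rel `` {G}"
    then obtain h where h: "digraph_isomorphism h" and K: "K = app_iso h G"
      by (auto simp: iso_rel_def digraph_iso_def)
    have "bij_betw (iso_verts h \<circ> f) {..<n} (verts K)"
      using f h K digraph_isomorphism_inj_on_verts by (intro bij_betw_trans) (auto intro: inj_on_imp_bij_betw)
    moreover have "bij_betw (iso_arcs h \<circ> g) {..<length ps} (arcs K)"
      using g h K digraph_isomorphism_inj_on_arcs by (intro bij_betw_trans) (auto intro: inj_on_imp_bij_betw)
    moreover have "tail K ((iso_arcs h \<circ> g) i) = (iso_verts h \<circ> f) (fst (ps ! i)) \<and>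
        head K ((iso_arcs h \<circ> g) i) = (iso_verts h \<circ> f) (snd (ps ! i))" if "i < length ps" for i
      using ends[OF that] iso_verts_tail[OF h g_arc[OF that]] iso_verts_head[OF h g_arc[OF that]] K by simp
    moreover have "wf_digraph K" unfolding K by (rule wf_digraphI_app_iso[OF h])
    ultimately show "presented_by n ps K"
      unfolding presented_by_def by blast
  next
    fix K :: "('a, 'b) pre_digraph" assume "K \<in> {K. presented_by n ps K}"
    then obtain f' g' where f': "bij_betw f' {..<n} (verts K)" and g': "bij_betw g' {..<length ps} (arcs K)"
      and ends': "\<And>i. i < length ps \<Longrightarrow> tail K (g' i) = f' (fst (ps ! i)) \<and> head K (g' i) = f' (snd (ps ! i))"
      by (auto simp: presented_by_def)
    \<comment> \<open>\<open>app_iso\<close> takes its end maps from \<open>h\<close>, so using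
      those of \<open>K\<close> makes the image equal to \<open>K\<close> as a record, also off the
      arc set.\<close>
    define h where "h = \<lparr> iso_verts = f' \<circ> inv_into {..<n} f, iso_arcs = g' \<circ> inv_into {..<length ps} g,
      iso_head = head K, iso_tail = tail K \<rparr>"
    have hv: "bij_betw (iso_verts h) (verts G) (verts K)"
      unfolding h_def using bij_betw_trans[OF bij_betw_inv_into[OF f] f'] by simp
    have ha: "bij_betw (iso_arcs h) (arcs G) (arcs K)"
      unfolding h_def using bij_betw_trans[OF bij_betw_inv_into[OF g] g'] by simp
    have "iso_verts h (tail G a) = iso_tail h (iso_arcs h a) \<and> iso_verts h (head G a) = iso_head h (iso_arcs h a)"
      if "a \<in> arcs G" for a
    proof -
      have "a \<in> g ` {..<length ps}" using that bij_betw_imp_surj_on[OF g] by simp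
      then obtain i where i: "i < length ps" "a = g i" by auto
      have "ps ! i \<in> {..<n} \<times> {..<n}" using ps i nth_mem by blast
      then have "fst (ps ! i) < n" "snd (ps ! i) < n" by (auto simp: mem_Times_iff)
      then show ?thesis
        using ends[OF i(1)] ends'[OF i(1)] bij_betw_inv_into_left[OF f] bij_betw_inv_into_left[OF g] i
        by (simp add: h_def)
    qed
    then have "digraph_isomorphism h"
      using hv ha wf_digraph_axioms by (auto simp: digraph_isomorphism_def bij_betw_def)
    moreover have "K = app_iso h G"
      using hv ha by (intro pre_digraph.equality) (auto simp: bij_betw_def h_def)
    ultimately show "K \<in> iso_rel `` {G}"
      by (auto simp: iso_rel_def digraph_iso_def)
  }
qed

lemma (in fin_digraph) card_arcs_regular:
  assumes "regular_digraph k G"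
  shows "card (arcs G) = k * card (verts G)"
proof -
  have "card (arcs G) = (\<Sum>e\<in>arcs G. 1)" by simp
  also have "\<dots> = (\<Sum>v\<in>verts G. \<Sum>e\<in>{e \<in> arcs G. tail G e = v}. 1)"
    by (rule sum.group[symmetric]) auto
  also have "\<dots> = (\<Sum>v\<in>verts G. out_degree G v)"
    by (simp add: out_degree_def out_arcs_def)
  also have "\<dots> = k * card (verts G)"
    using assms by (simp add: regular_digraph_def)
  finally show ?thesis .
qed

text \<open>A regular digraph with \<open>n\<close> vertices has \<open>k * n\<close> arcs, so only
  finitely many codes occur for \<open>n \<le> N\<close>.\<close>

lemma finite_iso_classes_regular:
  assumes "\<And>G. G \<in> S \<Longrightarrow> fin_digraph G \<and> regular_digraph k G \<and> card (verts G) \<le> N"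
  shows "finite (S // iso_rel)"
proof (rule finite_subset)
  let ?C = "\<Union>n\<le>N. Pair n ` {ps. set ps \<subseteq> {..<n} \<times> {..<n} \<and> length ps = k * n}"
  show "finite ((\<lambda>(n, ps). {K. presented_by n ps K}) ` ?C)"
    by (intro finite_imageI finite_UN_I finite_lists_length_eq) auto
  show "S // iso_rel \<subseteq> (\<lambda>(n, ps). {K. presented_by n ps K}) ` ?C"
  proof
    fix X assume "X \<in> S // iso_rel"
    then obtain G where G: "G \<in> S" "X = iso_rel `` {G}" by (auto simp: quotient_def)
    then interpret fin_digraph G using assms by blast
    obtain ps where ps: "set ps \<subseteq> {..<card (verts G)} \<times> {..<card (verts G)}"
      "length ps = card (arcs G)" "presented_by (card (verts G)) ps G"
      using fin_digraph_presented[OF fin_digraph_axioms] by blast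
    have "(card (verts G), ps) \<in> ?C"
      using ps assms[OF G(1)] card_arcs_regular[of k] by auto
    then show "X \<in> (\<lambda>(n, ps). {K. presented_by n ps K}) ` ?C"
      using iso_class_presented[OF ps(3,1)] G(2) by (intro image_eqI[where x = "(card (verts G), ps)"]) auto
  qed
qed

theorem theorem4p3:
  fixes k m r :: nat and \<epsilon> :: real
  assumes "k \<ge> 2" and "m \<ge> 1" and "r \<ge> 1" and "\<epsilon> > 0"
  shows "finite ({D :: ('a, 'b) pre_digraph.
             fin_digraph D \<and> Digraph_Component.connected D \<and> regular_digraph k D \<and>
             periodic m D \<and> r_normal r D \<and> rho D \<le> sqrt (real k) - \<epsilon>} // iso_rel)
       \<and> (\<nexists>F :: ('a, 'b) pre_digraph set.
             infinite (F // iso_rel) \<and> almost_normal F \<and>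
             (\<forall>D \<in> F. fin_digraph D \<and> Digraph_Component.connected D \<and> regular_digraph k D \<and>
                periodic m D \<and> rho D \<le> sqrt (real k) - \<epsilon>))"
proof -
  have k: "k \<ge> 1" using assms(1) by simp
  \<comment> \<open>Stated for any set and any \<open>r'\<close>, to serve both the given
    \<open>r\<close> and the bound hidden in \<open>almost_normal\<close>.\<close>
  have fin: "finite (S // iso_rel)"
    if S: "\<forall>D \<in> S. fin_digraph D \<and> Digraph_Component.connected D \<and> regular_digraph k D \<and>
      periodic m D \<and> r_normal r' D \<and> rho D \<le> sqrt (real k) - \<epsilon>"
    for S :: "('a, 'b) pre_digraph set" and r'
  proof -
    obtain N where "\<forall>G :: ('a, 'b) pre_digraph.
      fin_digraph G \<and> Digraph_Component.connected G \<and> regular_digraph k G \<and> periodic m G \<and>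
      r_normal r' G \<and> rho G \<le> sqrt (real k) - \<epsilon> \<longrightarrow> card (verts G) \<le> N"
      using card_verts_bounded[OF k assms(4)] by blast
    then show ?thesis using S by (intro finite_iso_classes_regular[of S k N]) blast
  qed
  show ?thesis
  proof (intro conjI notI)
    show "finite ({D :: ('a, 'b) pre_digraph.
             fin_digraph D \<and> Digraph_Component.connected D \<and> regular_digraph k D \<and>
             periodic m D \<and> r_normal r D \<and> rho D \<le> sqrt (real k) - \<epsilon>} // iso_rel)"
      by (rule fin[of _ r]) blast
  next
    assume "\<exists>F :: ('a, 'b) pre_digraph set.
             infinite (F // iso_rel) \<and> almost_normal F \<and>
             (\<forall>D \<in> F. fin_digraph D \<and> Digraph_Component.connected D \<and> regular_digraph k D \<and>
                periodic m D \<and> rho D \<le> sqrt (real k) - \<epsilon>)"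
    then obtain F :: "('a, 'b) pre_digraph set" and r' where F: "infinite (F // iso_rel)"
      "\<forall>D \<in> F. r_normal r' D"
      "\<forall>D \<in> F. fin_digraph D \<and> Digraph_Component.connected D \<and> regular_digraph k D \<and>
                periodic m D \<and> rho D \<le> sqrt (real k) - \<epsilon>"
      unfolding almost_normal_def by blast
    then show False using fin[of F r'] by blast
  qed
qed

end
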